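(* Let $I\subset K[x_1,\ldots,x_n]$ be a graded ideal and let $m<n$. Then there exists an open and dense subset $D\subset\Pi$ such that for every rational projection $\pi:\mathbb{R}^n\to\mathbb{R}^{m+1}$ whose class lies in $D$, and for any basis $u^{(1)},\ldots,u^{(l)}\in\mathbb{Z}^n$ ($l=n-m-1$) of $\ker\pi$, we have $\pi^{-1}\pi(T(I))=T(\tilde J_0)$ as sets, where $\tilde J_0$ is the ideal constructed from $I$ and $u^{(1)},\ldots,u^{(l)}$ as described in the context.
   Context: $K$ is an algebraically closed field of characteristic $0$ with trivial valuation. For $f=\sum_\nu a_\nu x^\nu$ and $\omega\in\mathbb{R}^n$, $\mathrm{in}_\omega(f)$ is the sum of the terms with $\omega\cdot\nu$ minimal, and for an ideal $I$, $T(I)=\{\omega\in\mathbb{R}^n:\mathrm{in}_\omega(f)\text{ is not a monomial for every }f\in I\}$. A rational projection is a linear map $\pi:\mathbb{R}^n\to\mathbb{R}^{m+1}$, $x\mapsto Ax$, with $A$ a rational matrix of maximal rank $m+1$. $\Pi$ is the set of equivalence classes of rational projections under $\pi\sim\pi'\iff\ker\pi=\ker\pi'$; it is identified with the set of rational (i.e. spanned by rational vectors) linear subspaces of $\mathbb{R}^n$ of dimension $n-m-1$. The topology on $\Pi$ is generated by the subbasis of sets $O_V=\{U\in\Pi:U\cap V=\{0\}\}$, $V$ ranging over rational subspaces of dimension $m+1$. Construction of $\tilde J_0$: in $K[x,\lambda,\mu]=K[x_1,\ldots,x_n,\lambda_1,\ldots,\lambda_l,\mu_1,\ldots,\mu_l]$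 put $t_k=x_k\prod_{u^{(j)}_k\geq 0}\lambda_j^{u^{(j)}_k}\prod_{u^{(j)}_k<0}\mu_j^{-u^{(j)}_k}$ for $k=1,\ldots,n$, let $J_0=(f(t_1,\ldots,t_n):f\in I)\subset K[x,\lambda,\mu]$, let $W=(\lambda_i\mu_i-1:i=1,\ldots,l)$, $\varphi:K[x,\lambda,\mu]\to K[x,\lambda,\mu]/W$ the canonical epimorphism, and, identifying $K[x_1,\ldots,x_n]$ with its (isomorphic) image under $\varphi$, set $\tilde J_0=\varphi(J_0)\cap K[x_1,\ldots,x_n]$. *)

theory Defs
  imports "HOL-Analysis.Analysis" "HOL-Library.Poly_Mapping" "HOL-Computational_Algebra.Polynomial"
begin

type_synonym ('v, 'a) mpoly = "('v \<Rightarrow>\<^sub>0 nat) \<Rightarrow>\<^sub>0 'a"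

definition mvar :: "'v \<Rightarrow> ('v, 'a::comm_ring_1) mpoly" where
  "mvar v = Poly_Mapping.single (Poly_Mapping.single v 1) 1"

definition mconst :: "'a::comm_ring_1 \<Rightarrow> ('v, 'a) mpoly" where
  "mconst c = Poly_Mapping.single 0 c"

definition msubst :: "('v \<Rightarrow> ('w, 'a::comm_ring_1) mpoly) \<Rightarrow> ('v, 'a) mpoly \<Rightarrow> ('w, 'a) mpoly" where
  "msubst \<sigma> f = (\<Sum>\<nu>\<in>Poly_Mapping.keys f. mconst (Poly_Mapping.lookup f \<nu>) * (\<Prod>k\<in>Poly_Mapping.keys (\<nu>::'v \<Rightarrow>\<^sub>0 nat). \<sigma> k ^ Poly_Mapping.lookup \<nu> k))"

definition is_ideal_set :: "'r::comm_ring_1 set \<Rightarrow> bool" where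
  "is_ideal_set J \<longleftrightarrow> 0 \<in> J \<and> (\<forall>a\<in>J. \<forall>b\<in>J. a + b \<in> J) \<and> (\<forall>r. \<forall>a\<in>J. r * a \<in> J)"

definition gen_ideal :: "'r::comm_ring_1 set \<Rightarrow> 'r set" where
  "gen_ideal S = \<Inter>{J. is_ideal_set J \<and> S \<subseteq> J}"

definition mdeg :: "('v \<Rightarrow>\<^sub>0 nat) \<Rightarrow> nat" where
  "mdeg \<nu> = (\<Sum>k\<in>Poly_Mapping.keys \<nu>. Poly_Mapping.lookup \<nu> k)"

definition homog_part :: "nat \<Rightarrow> ('v, 'a::comm_ring_1) mpoly \<Rightarrow> ('v, 'a) mpoly" where
  "homog_part d f = (\<Sum>\<nu>\<in>{\<nu>\<in>Poly_Mapping.keys f. mdeg \<nu> = d}. Poly_Mapping.single \<nu> (Poly_Mapping.lookup f \<nu>))"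

definition graded_ideal :: "('v, 'a::comm_ring_1) mpoly set \<Rightarrow> bool" where
  "graded_ideal I \<longleftrightarrow> is_ideal_set I \<and> (\<forall>f\<in>I. \<forall>d. homog_part d f \<in> I)"

definition wdot :: "real^'n \<Rightarrow> ('n::finite \<Rightarrow>\<^sub>0 nat) \<Rightarrow> real" where
  "wdot \<omega> \<nu> = (\<Sum>k\<in>Poly_Mapping.keys \<nu>. \<omega> $ k * real (Poly_Mapping.lookup \<nu> k))"

text \<open>Initial form in_omega(f): sum of the terms with omega . nu minimal (trivial valuation).\<close>
definition initial_form :: "real^'n \<Rightarrow> ('n::finite, 'a::comm_ring_1) mpoly \<Rightarrow> ('n, 'a) mpoly" where
  "initial_form \<omega> f = (\<Sum>\<nu>\<in>{\<nu>\<in>Poly_Mapping.keys f. \<forall>\<mu>\<in>Poly_Mapping.keys f. wdot \<omega> \<nu> \<le> wdot \<omega> \<mu>}.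
      Poly_Mapping.single \<nu> (Poly_Mapping.lookup f \<nu>))"

definition is_monomial :: "('v, 'a::comm_ring_1) mpoly \<Rightarrow> bool" where
  "is_monomial p \<longleftrightarrow> (\<exists>\<nu> c. c \<noteq> 0 \<and> p = Poly_Mapping.single \<nu> c)"

definition trop :: "('n::finite, 'a::comm_ring_1) mpoly set \<Rightarrow> (real^'n) set" where
  "trop I = {\<omega>. \<forall>f\<in>I. \<not> is_monomial (initial_form \<omega> f)}"

text \<open>Variables of K[x, lambda, mu]: Inl k is x_k, Inr (j, True) is lambda_j, Inr (j, False) is mu_j.\<close>
definition tvar :: "(nat \<Rightarrow> int^'n) \<Rightarrow> nat \<Rightarrow> 'n::finite \<Rightarrow> ('n + nat \<times> bool, 'a::comm_ring_1) mpoly" where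
  "tvar u l k = mvar (Inl k) *
     (\<Prod>j<l. if u j $ k \<ge> 0 then mvar (Inr (j, True)) ^ nat (u j $ k)
             else mvar (Inr (j, False)) ^ nat (- u j $ k))"

definition J0 :: "('n::finite, 'a::comm_ring_1) mpoly set \<Rightarrow> (nat \<Rightarrow> int^'n) \<Rightarrow> nat
    \<Rightarrow> ('n + nat \<times> bool, 'a) mpoly set" where
  "J0 I u l = gen_ideal (msubst (tvar u l) ` I)"

definition Wideal :: "nat \<Rightarrow> ('n + nat \<times> bool, 'a::comm_ring_1) mpoly set" where
  "Wideal l = gen_ideal ((\<lambda>i. mvar (Inr (i, True)) * mvar (Inr (i, False)) - 1) ` {..<l})"

text \<open>phi(J0) intersected with K[x] (identified with its image in the quotient modulo W).\<close>
definition J0_tilde :: "('n::finite, 'a::comm_ring_1) mpoly set \<Rightarrow> (nat \<Rightarrow> int^'n) \<Rightarrow> nat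
    \<Rightarrow> ('n, 'a) mpoly set" where
  "J0_tilde I u l = {g. \<exists>h\<in>J0 I u l. h - msubst (\<lambda>k. mvar (Inl k)) g \<in> Wideal l}"

definition rational_vec :: "real^'n \<Rightarrow> bool" where
  "rational_vec x \<longleftrightarrow> (\<forall>k. x $ k \<in> \<rat>)"

definition rational_matrix :: "real^'n^'m \<Rightarrow> bool" where
  "rational_matrix A \<longleftrightarrow> (\<forall>i k. A $ i $ k \<in> \<rat>)"

definition rational_subspace :: "(real^'n) set \<Rightarrow> bool" where
  "rational_subspace U \<longleftrightarrow> (\<exists>B. (\<forall>b\<in>B. rational_vec b) \<and> U = span B)"

text \<open>Pi for projections to R^c (c = m+1): rational subspaces of dimension n - c.\<close>
definition PiSpace :: "nat \<Rightarrow> (real^'n::finite) set set" where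
  "PiSpace c = {U. rational_subspace U \<and> dim U = CARD('n) - c}"

definition O_set :: "nat \<Rightarrow> (real^'n::finite) set \<Rightarrow> (real^'n) set set" where
  "O_set c V = {U \<in> PiSpace c. U \<inter> V = {0}}"

text \<open>Topology generated by the subbasis O_V (V rational of dimension c): open sets are
  unions of finite intersections of subbasic sets (the empty intersection being Pi).\<close>
definition Pi_open :: "nat \<Rightarrow> (real^'n::finite) set set \<Rightarrow> bool" where
  "Pi_open c D \<longleftrightarrow> D \<subseteq> PiSpace c \<and>
     (\<forall>U\<in>D. \<exists>F. finite F \<and> (\<forall>V\<in>F. rational_subspace V \<and> dim V = c) \<and>
        U \<in> PiSpace c \<inter> \<Inter>(O_set c ` F) \<and> PiSpace c \<inter> \<Inter>(O_set c ` F) \<subseteq> D)"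

definition Pi_dense :: "nat \<Rightarrow> (real^'n::finite) set set \<Rightarrow> bool" where
  "Pi_dense c D \<longleftrightarrow> D \<subseteq> PiSpace c \<and> (\<forall>W. Pi_open c W \<and> W \<noteq> {} \<longrightarrow> W \<inter> D \<noteq> {})"

definition int_vec :: "int^'n \<Rightarrow> real^'n" where
  "int_vec v = (\<chi> k. real_of_int (v $ k))"

end

theory Submission
  imports Defs
begin

text \<open>After inverting the \<open>\<lambda>\<^sub>j\<close>, the substitution \<open>x\<^sub>k \<mapsto> t\<^sub>k\<close> is an automorphism, so \<open>J\<^sub>0\<close>-tilde
  consists of the polynomials all of whose components for the \<open>\<int>\<^sup>l\<close>-grading by \<open>u\<close> lie in
  \<open>I\<close>. For every projection the tropical variety of this ideal is \<open>T(I) + span u\<close>, so \<open>D\<close> can be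
  all of \<open>\<Pi>\<close>. It suffices to treat a single \<open>u\<close>. If \<open>\<omega> + v u\<close> avoids \<open>T(I)\<close> for all real
  \<open>v\<close>, then finitely many elements of \<open>I\<close> have monomial initial forms that cover all \<open>v\<close>, where
  gradedness (through a Groebner basis) takes care of \<open>v \<rightarrow> \<plusminus>\<infinity>\<close>. The \<open>u\<close>-components of these elements
  form a square matrix with row sums in \<open>I\<close>. A convex potential on the index set makes the diagonal
  dominant with respect to \<open>\<omega>\<close>, and eliminating gives an element of \<open>I\<close>, essentially the determinant,
  that is homogeneous for \<open>u\<close> and has a monomial \<open>\<omega>\<close>-initial form.\<close>

subsection \<open>Polynomials, initial monomials and weight components\<close>

abbreviation "coef \<equiv> Poly_Mapping.lookup"
abbreviation "supp \<equiv> Poly_Mapping.keys"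
abbreviation "trm \<equiv> Poly_Mapping.single"

lemma sum_trm: "(\<Sum>\<nu>\<in>supp f. trm \<nu> (coef f \<nu>)) = f"
  by (rule poly_mapping_eqI)
    (auto simp: lookup_sum lookup_single when_def in_keys_iff)

lemma poly_sum_induct [case_names zero trm add]:
  fixes f :: "'k \<Rightarrow>\<^sub>0 'a::comm_monoid_add"
  assumes "P 0" "\<And>\<nu> c. P (trm \<nu> c)" "\<And>f g. P f \<Longrightarrow> P g \<Longrightarrow> P (f + g)"
  shows "P f"
proof -
  have "P (\<Sum>\<nu>\<in>A. trm \<nu> (coef f \<nu>))" if "finite A" for A
    using that by induction (auto intro: assms)
  from this[of "supp f"] show ?thesis by (simp add: sum_trm)
qed

text \<open>Arbitrary \<open>P\<close> makes homogeneous parts, initial forms and weight components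
  instances of one operation.\<close>

definition filt :: "('k \<Rightarrow> bool) \<Rightarrow> ('k \<Rightarrow>\<^sub>0 'a::comm_monoid_add) \<Rightarrow> 'k \<Rightarrow>\<^sub>0 'a" where
  "filt P f = (\<Sum>\<nu>\<in>{\<nu>\<in>supp f. P \<nu>}. trm \<nu> (coef f \<nu>))"

lemma lookup_filt: "coef (filt P f) \<nu> = (if P \<nu> then coef f \<nu> else 0)"
  by (simp add: filt_def lookup_sum lookup_single when_def in_keys_iff)

lemma supp_filt: "supp (filt P f) = {\<nu>\<in>supp f. P \<nu>}"
  by (auto simp: in_keys_iff lookup_filt split: if_splits)

lemma filt_zero [simp]: "filt P 0 = 0"
  by (rule poly_mapping_eqI) (simp add: lookup_filt)

lemma filt_add: "filt P (f + g) = filt P f + filt P g"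
  by (rule poly_mapping_eqI) (simp add: lookup_filt lookup_add)

lemma filt_minus: "filt P (f - g) = filt P f - filt P (g :: _ \<Rightarrow>\<^sub>0 'a::ab_group_add)"
  by (rule poly_mapping_eqI) (simp add: lookup_filt lookup_minus)

lemma filt_filt: "filt P (filt Q f) = filt (\<lambda>\<nu>. Q \<nu> \<and> P \<nu>) f"
  by (rule poly_mapping_eqI) (simp add: lookup_filt)

lemma filt_trm: "filt P (trm \<nu> c) = (if P \<nu> then trm \<nu> c else 0)"
  by (rule poly_mapping_eqI) (auto simp: lookup_filt lookup_single when_def)

lemma filt_self: "(\<And>\<nu>. \<nu> \<in> supp f \<Longrightarrow> P \<nu>) \<Longrightarrow> filt P f = f"
  by (rule poly_mapping_eqI) (auto simp: lookup_filt in_keys_iff)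

lemma filt_none: "(\<And>\<nu>. \<nu> \<in> supp f \<Longrightarrow> \<not> P \<nu>) \<Longrightarrow> filt P f = 0"
  by (rule poly_mapping_eqI) (auto simp: lookup_filt in_keys_iff)

lemma sum_filt_fibres:
  assumes "finite W" "\<And>\<nu>. \<nu> \<in> supp f \<Longrightarrow> d \<nu> \<in> W"
  shows "(\<Sum>w\<in>W. filt (\<lambda>\<nu>. d \<nu> = w) f) = f"
proof (rule poly_mapping_eqI)
  fix \<nu>
  show "coef (\<Sum>w\<in>W. filt (\<lambda>\<nu>. d \<nu> = w) f) \<nu> = coef f \<nu>"
  proof (cases "\<nu> \<in> supp f")
    case True
    then show ?thesis using assms by (simp add: lookup_sum lookup_filt)
  next
    case False
    then show ?thesis by (auto simp: lookup_sum lookup_filt in_keys_iff intro!: sum.neutral)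
  qed
qed

lemma homog_part_filt: "homog_part d f = filt (\<lambda>\<nu>. mdeg \<nu> = d) f"
  by (simp add: homog_part_def filt_def)

lemma is_ideal_setD:
  assumes "is_ideal_set J"
  shows "0 \<in> J" "\<And>a b. a \<in> J \<Longrightarrow> b \<in> J \<Longrightarrow> a + b \<in> J" "\<And>r a. a \<in> J \<Longrightarrow> r * a \<in> J"
    "\<And>a b. a \<in> J \<Longrightarrow> b \<in> J \<Longrightarrow> a - b \<in> J"
proof -
  show *: "0 \<in> J" "\<And>a b. a \<in> J \<Longrightarrow> b \<in> J \<Longrightarrow> a + b \<in> J" "\<And>r a. a \<in> J \<Longrightarrow> r * a \<in> J"
    using assms by (auto simp: is_ideal_set_def)
  fix a b assume "a \<in> J" "b \<in> J"
  then have "a + (-1) * b \<in> J" using * by blast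
  then show "a - b \<in> J" by simp
qed

lemma ideal_sum:
  assumes "is_ideal_set J" "\<And>x. x \<in> A \<Longrightarrow> f x \<in> J"
  shows "sum f A \<in> J"
  using assms(2) by (induction A rule: infinite_finite_induct) (auto intro: is_ideal_setD[OF assms(1)])

text \<open>Every polynomial is a sum of terms, so absorbing terms suffices; multiplication by a
  term merely shifts components.\<close>

lemma is_ideal_setI_trm:
  fixes J :: "('k::comm_monoid_add \<Rightarrow>\<^sub>0 'a::comm_ring_1) set"
  assumes "0 \<in> J" "\<And>a b. a \<in> J \<Longrightarrow> b \<in> J \<Longrightarrow> a + b \<in> J" "\<And>\<nu> c a. a \<in> J \<Longrightarrow> trm \<nu> c * a \<in> J"
  shows "is_ideal_set J"
proof -
  have "r * a \<in> J" if "a \<in> J" for r a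
    by (induction r rule: poly_sum_induct) (use that assms in \<open>auto simp: distrib_right\<close>)
  then show ?thesis using assms by (auto simp: is_ideal_set_def)
qed

lemma gen_ideal_is_ideal: "is_ideal_set (gen_ideal S)"
  unfolding gen_ideal_def is_ideal_set_def by blast

lemma gen_ideal_superset: "S \<subseteq> gen_ideal S"
  unfolding gen_ideal_def by blast

lemma gen_ideal_least: "is_ideal_set J \<Longrightarrow> S \<subseteq> J \<Longrightarrow> gen_ideal S \<subseteq> J"
  unfolding gen_ideal_def by blast

section \<open>Weights and degrees of exponents\<close>

lemma wdot_UNIV: "wdot \<omega> \<nu> = (\<Sum>k\<in>UNIV. \<omega> $ k * real (coef \<nu> k))"
  unfolding wdot_def by (rule sum.mono_neutral_left) (auto simp: in_keys_iff)

lemma wdot_add: "wdot \<omega> (\<nu> + \<mu>) = wdot \<omega> \<nu> + wdot \<omega> \<mu>"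
  by (simp add: wdot_UNIV lookup_add distrib_left sum.distrib)

lemma wdot_add_left: "wdot (\<omega> + \<omega>') \<nu> = wdot \<omega> \<nu> + wdot \<omega>' \<nu>"
  by (simp add: wdot_UNIV distrib_right sum.distrib)

lemma wdot_scaleR: "wdot (c *\<^sub>R \<omega>) \<nu> = c * wdot \<omega> \<nu>"
  by (simp add: wdot_UNIV sum_distrib_left mult.assoc)

definition udeg :: "int^'n \<Rightarrow> ('n::finite \<Rightarrow>\<^sub>0 nat) \<Rightarrow> int" where
  "udeg u \<nu> = (\<Sum>k\<in>UNIV. u $ k * int (coef \<nu> k))"

lemma wdot_int_vec: "wdot (int_vec u) \<nu> = real_of_int (udeg u \<nu>)"
  by (simp add: wdot_UNIV udeg_def int_vec_def)

lemma udeg_add: "udeg u (\<nu> + \<mu>) = udeg u \<nu> + udeg u \<mu>"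
  by (simp add: udeg_def lookup_add distrib_left sum.distrib)

lemma udeg_zero [simp]: "udeg u 0 = 0"
  by (simp add: udeg_def)

lemma mdeg_UNIV: "mdeg (\<nu> :: 'n::finite \<Rightarrow>\<^sub>0 nat) = (\<Sum>k\<in>UNIV. coef \<nu> k)"
  unfolding mdeg_def by (rule sum.mono_neutral_left) (auto simp: in_keys_iff)

lemma mdeg_add: "mdeg ((\<nu> :: 'n::finite \<Rightarrow>\<^sub>0 nat) + \<mu>) = mdeg \<nu> + mdeg \<mu>"
  by (simp add: mdeg_UNIV lookup_add sum.distrib)

text \<open>The smallest key leads, as for initial forms; a tie at the minimum means that there is
  no leading exponent. Generic \<open>\<kappa>\<close> covers real weights and monomial orders
  alike.\<close>

definition lead :: "('k \<Rightarrow> 'o::linorder) \<Rightarrow> 'k \<Rightarrow> ('k \<Rightarrow>\<^sub>0 'a::zero) \<Rightarrow> bool" where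
  "lead \<kappa> \<nu> f \<longleftrightarrow> \<nu> \<in> supp f \<and> (\<forall>\<mu>\<in>supp f. \<mu> \<noteq> \<nu> \<longrightarrow> \<kappa> \<nu> < \<kappa> \<mu>)"

text \<open>The terms of the initial form sit exactly at the minimisers of the weight, so being a
  monomial means a unique minimiser. For \<open>f = 0\<close> both sides fail.\<close>

lemma is_monomial_initial_form: "is_monomial (initial_form \<omega> f) \<longleftrightarrow> (\<exists>\<nu>. lead (wdot \<omega>) \<nu> f)"
proof -
  let ?P = "\<lambda>\<nu>. \<forall>\<mu>\<in>supp f. wdot \<omega> \<nu> \<le> wdot \<omega> \<mu>"
  have eq: "initial_form \<omega> f = filt ?P f"
    by (simp add: initial_form_def filt_def)
  show ?thesis
  proof
    assume "is_monomial (initial_form \<omega> f)"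
    then obtain \<nu> c where c: "c \<noteq> 0" "filt ?P f = trm \<nu> c"
      by (auto simp: is_monomial_def eq)
    then have "supp (filt ?P f) = {\<nu>}" by simp
    then have s: "{\<nu>\<in>supp f. ?P \<nu>} = {\<nu>}" by (simp add: supp_filt)
    then have "\<nu> \<in> supp f" "?P \<nu>" by auto
    moreover have "wdot \<omega> \<nu> < wdot \<omega> \<mu>" if "\<mu> \<in> supp f" "\<mu> \<noteq> \<nu>" for \<mu>
    proof (rule ccontr)
      assume "\<not> wdot \<omega> \<nu> < wdot \<omega> \<mu>"
      then have "?P \<mu>" using \<open>?P \<nu>\<close> by force
      then show False using s that by auto
    qed
    ultimately show "\<exists>\<nu>. lead (wdot \<omega>) \<nu> f" by (auto simp: lead_def)
  next
    assume "\<exists>\<nu>. lead (wdot \<omega>) \<nu> f"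
    then obtain \<nu> where l: "lead (wdot \<omega>) \<nu> f" ..
    then have "?P \<nu>" unfolding lead_def by (metis order.refl order.strict_implies_order)
    moreover have "\<mu> = \<nu>" if "\<mu> \<in> supp f" "?P \<mu>" for \<mu>
      using l that unfolding lead_def by (metis linorder_not_le)
    ultimately have "supp (filt ?P f) = {\<nu>}"
      using l by (auto simp: supp_filt lead_def)
    then have "filt ?P f = trm \<nu> (coef (filt ?P f) \<nu>)"
      using sum_trm[of "filt ?P f"] by simp
    moreover have "coef (filt ?P f) \<nu> \<noteq> 0"
      using \<open>supp (filt ?P f) = {\<nu>}\<close> by (auto simp flip: in_keys_iff)
    ultimately show "is_monomial (initial_form \<omega> f)"
      unfolding is_monomial_def eq by blast
  qed
qed

lemma trop_iff: "\<omega> \<in> trop I \<longleftrightarrow> (\<forall>f\<in>I. \<forall>\<nu>. \<not> lead (wdot \<omega>) \<nu> f)"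
  by (auto simp: trop_def is_monomial_initial_form)

lemma lead_filt: "lead \<kappa> \<nu> f \<Longrightarrow> P \<nu> \<Longrightarrow> lead \<kappa> \<nu> (filt P f)"
  by (auto simp: lead_def supp_filt)

lemma lead_exists:
  fixes \<kappa> :: "'k \<Rightarrow> 'o::linorder"
  assumes "inj \<kappa>" "f \<noteq> 0"
  shows "\<exists>\<nu>. lead \<kappa> \<nu> f"
proof -
  have ne: "supp f \<noteq> {}"
    using assms(2) by (metis all_not_in_conv in_keys_iff lookup_zero poly_mapping_eqI)
  define \<nu> where "\<nu> = arg_min_on \<kappa> (supp f)"
  have "\<nu> \<in> supp f" "\<forall>\<mu>\<in>supp f. \<kappa> \<nu> \<le> \<kappa> \<mu>"
    using ne by (auto simp: \<nu>_def arg_min_if_finite arg_min_least)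
  then show ?thesis
    using injD[OF assms(1)] by (auto simp: lead_def order.strict_iff_order)
qed

section \<open>Multiplication by a single term\<close>

lemma supp_trm_mult:
  fixes f :: "('k::cancel_comm_monoid_add) \<Rightarrow>\<^sub>0 'a::comm_semiring_1"
  shows "supp (trm \<alpha> c * f) \<subseteq> (\<lambda>\<nu>. \<alpha> + \<nu>) ` supp f"
  using keys_mult[of "trm \<alpha> c" f] by (auto split: if_splits)

lemma lookup_trm_mult:
  fixes f :: "('k::cancel_comm_monoid_add) \<Rightarrow>\<^sub>0 'a::comm_semiring_1"
  shows "coef (trm \<alpha> c * f) (\<alpha> + \<nu>) = c * coef f \<nu>"
proof (induction f rule: poly_sum_induct)
  case (trm \<mu> d)
  then show ?case by (auto simp: mult_single lookup_single when_def)
qed (auto simp: lookup_add distrib_left)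

lemma lead_trm_mult:
  fixes f :: "('k::cancel_comm_monoid_add) \<Rightarrow>\<^sub>0 'a::idom" and \<kappa> :: "'k \<Rightarrow> 'o::linordered_ab_group_add"
  assumes "\<And>\<mu> \<nu>. \<kappa> (\<mu> + \<nu>) = \<kappa> \<mu> + \<kappa> \<nu>" "lead \<kappa> \<nu> f" "c \<noteq> 0"
  shows "lead \<kappa> (\<alpha> + \<nu>) (trm \<alpha> c * f)"
  using assms supp_trm_mult[of \<alpha> c f] unfolding lead_def
  by (auto simp: in_keys_iff lookup_trm_mult)

lemma filt_trm_mult:
  fixes f :: "('k::cancel_comm_monoid_add) \<Rightarrow>\<^sub>0 'a::comm_semiring_1"
  shows "filt P (trm \<alpha> c * f) = trm \<alpha> c * filt (\<lambda>\<nu>. P (\<alpha> + \<nu>)) f"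
proof (induction f rule: poly_sum_induct)
  case (trm \<mu> d)
  then show ?case by (simp add: mult_single filt_trm)
qed (auto simp: filt_add distrib_left)

text \<open>For an ideal \<open>I\<close> this is the largest ideal inside \<open>I\<close> that is
  homogeneous for the weight \<open>u\<close>.\<close>

definition core1 :: "int^'n \<Rightarrow> ('n::finite, 'a::comm_ring_1) mpoly set \<Rightarrow> ('n, 'a) mpoly set" where
  "core1 u I = {g. \<forall>w. filt (\<lambda>\<nu>. udeg u \<nu> = w) g \<in> I}"

definition core :: "(nat \<Rightarrow> int^'n) \<Rightarrow> nat \<Rightarrow> ('n::finite, 'a::comm_ring_1) mpoly set \<Rightarrow> ('n, 'a) mpoly set" where
  "core u l I = {g. \<forall>w. filt (\<lambda>\<nu>. \<forall>j<l. udeg (u j) \<nu> = w j) g \<in> I}"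

lemma core_0: "core u 0 I = I"
  by (simp add: core_def filt_self)

text \<open>A joint component is a component of a component. This reduces several vectors to
  repeated treatment of one.\<close>

lemma core_Suc: "core u (Suc l) I = core1 (u l) (core u l I)"
proof -
  have eq: "filt (\<lambda>\<nu>. udeg (u l) \<nu> = a \<and> (\<forall>j<l. udeg (u j) \<nu> = w j)) g
      = filt (\<lambda>\<nu>. \<forall>j<Suc l. udeg (u j) \<nu> = (w(l := a)) j) g" for a w and g :: "('a, 'b) mpoly"
    by (rule arg_cong[where f = "\<lambda>P. filt P g"]) (auto simp: less_Suc_eq)
  show ?thesis
    unfolding core_def core1_def mem_Collect_eq filt_filt eq
  proof (intro Collect_cong iffI allI)
    fix g w assume *: "\<forall>a w. filt (\<lambda>\<nu>. \<forall>j<Suc l. udeg (u j) \<nu> = (w(l := a)) j) g \<in> I"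
    from *[rule_format, of w "w l"] show "filt (\<lambda>\<nu>. \<forall>j<Suc l. udeg (u j) \<nu> = w j) g \<in> I"
      by (simp only: fun_upd_triv)
  qed (erule spec)
qed

text \<open>Taking components by degree and by \<open>u\<close> commutes, so the passage to the core
  can be iterated without losing gradedness.\<close>

lemma graded_core1:
  assumes "graded_ideal I"
  shows "graded_ideal (core1 u I)"
proof -
  have I: "is_ideal_set I" and h: "\<And>f d. f \<in> I \<Longrightarrow> homog_part d f \<in> I"
    using assms by (auto simp: graded_ideal_def)
  have "is_ideal_set (core1 u I)"
  proof (rule is_ideal_setI_trm)
    fix \<alpha> c a assume a: "a \<in> core1 u I"
    have "filt (\<lambda>\<nu>. udeg u \<nu> = w) (trm \<alpha> c * a) = trm \<alpha> c * filt (\<lambda>\<nu>. udeg u \<nu> = w - udeg u \<alpha>) a" for w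
      by (simp add: filt_trm_mult udeg_add eq_diff_eq add.commute)
    then show "trm \<alpha> c * a \<in> core1 u I"
      using a is_ideal_setD(3)[OF I] by (simp add: core1_def)
  qed (use is_ideal_setD[OF I] in \<open>auto simp: core1_def filt_add\<close>)
  moreover have "homog_part d f \<in> core1 u I" if "f \<in> core1 u I" for d f
  proof -
    have "filt (\<lambda>\<nu>. udeg u \<nu> = w) (homog_part d f) = homog_part d (filt (\<lambda>\<nu>. udeg u \<nu> = w) f)" for w
      by (simp add: homog_part_filt filt_filt conj_commute)
    then show ?thesis using that h by (simp add: core1_def)
  qed
  ultimately show ?thesis by (simp add: graded_ideal_def)
qed

text \<open>On one joint component the weight \<open>v\<close> is constant, so
  \<open>\<omega>\<close> and \<open>\<omega> + v\<close> order its exponents alike. A leading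
  exponent of \<open>g\<close> still leads in its component, which lies in \<open>I\<close>.\<close>

lemma trop_core_superset:
  assumes \<omega>: "\<omega> \<in> trop I" and v: "v \<in> span ((\<lambda>j. int_vec (u j)) ` {..<l})"
  shows "\<omega> + v \<in> trop (core u l I)"
  unfolding trop_iff
proof (intro ballI allI notI)
  fix g \<nu> assume g: "g \<in> core u l I" "lead (wdot (\<omega> + v)) \<nu> g"
  let ?P = "\<lambda>\<mu>. \<forall>j<l. udeg (u j) \<mu> = udeg (u j) \<nu>"
  have I: "filt ?P g \<in> I" using g(1) by (simp add: core_def)
  have lf: "lead (wdot (\<omega> + v)) \<nu> (filt ?P g)"
    using g(2) by (rule lead_filt) simp
  have eq: "wdot v \<mu> = wdot v \<nu>" if "?P \<mu>" for \<mu>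
    using v
  proof (induction rule: span_induct_alt)
    case base
    then show ?case by (simp add: wdot_UNIV)
  next
    case (step c x y)
    then show ?case using that by (auto simp: wdot_add_left wdot_scaleR wdot_int_vec)
  qed
  have "wdot (\<omega> + v) \<nu> < wdot (\<omega> + v) \<mu> \<longleftrightarrow> wdot \<omega> \<nu> < wdot \<omega> \<mu>" if "?P \<mu>" for \<mu>
    by (simp only: wdot_add_left eq[OF that] add_less_cancel_right)
  with lf have "lead (wdot \<omega>) \<nu> (filt ?P g)"
    unfolding lead_def supp_filt by blast
  then show False using \<omega> I unfolding trop_iff by blast
qed

subsection \<open>The ideal \<open>J\<^sub>0\<close>-tilde\<close>

text \<open>Linear extension of a map of exponents; coefficients landing on the same exponent add
  up.\<close>

definition push :: "('k \<Rightarrow> 'l) \<Rightarrow> ('k \<Rightarrow>\<^sub>0 'a::comm_monoid_add) \<Rightarrow> 'l \<Rightarrow>\<^sub>0 'a" where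
  "push \<phi> f = (\<Sum>\<nu>\<in>supp f. trm (\<phi> \<nu>) (coef f \<nu>))"

lemma push_zero [simp]: "push \<phi> 0 = 0"
  by (simp add: push_def)

lemma push_trm: "push \<phi> (trm \<nu> c) = trm (\<phi> \<nu>) c"
  by (simp add: push_def)

lemma push_add: "push \<phi> (f + g) = push \<phi> f + push \<phi> g"
  unfolding push_def by (rule setsum_keys_plus_distrib) (simp_all add: single_add)

lemma push_diff: "push \<phi> (f - g) = push \<phi> f - push \<phi> (g :: _ \<Rightarrow>\<^sub>0 'a::ab_group_add)"
  using push_add[of \<phi> "f - g" g] by simp

lemma push_push: "push \<phi> (push \<psi> f) = push (\<lambda>\<nu>. \<phi> (\<psi> \<nu>)) f"
  by (induction f rule: poly_sum_induct) (simp_all add: push_trm push_add)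

lemma push_id: "push (\<lambda>\<nu>. \<nu>) f = f"
  by (simp add: push_def sum_trm)

lemma filt_push: "filt P (push \<phi> f) = push \<phi> (filt (\<lambda>\<nu>. P (\<phi> \<nu>)) f)"
  by (induction f rule: poly_sum_induct) (simp_all add: push_trm push_add filt_trm filt_add)

lemma push_trm_mult:
  fixes f :: "('k::comm_monoid_add) \<Rightarrow>\<^sub>0 'a::comm_semiring_1"
  assumes "\<And>\<mu> \<nu>. \<phi> (\<mu> + \<nu>) = \<phi> \<mu> + \<phi> \<nu>"
  shows "push \<phi> (trm \<alpha> c * f) = trm (\<phi> \<alpha>) c * push \<phi> f"
  by (induction f rule: poly_sum_induct) (simp_all add: push_trm push_add distrib_left mult_single assms)

section \<open>Monomial substitutions as maps of exponents\<close>

lemma mvar_power: "(mvar v :: ('v, 'a::comm_ring_1) mpoly) ^ n = trm (trm v n) 1"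
  by (induction n) (simp_all add: mvar_def mult_single flip: single_add)

lemma prod_trm: "(\<Prod>k\<in>A. trm (e k) 1) = (trm (\<Sum>k\<in>A. e k) 1 :: 'k::comm_monoid_add \<Rightarrow>\<^sub>0 'a::comm_semiring_1)"
  by (induction A rule: infinite_finite_induct) (simp_all add: mult_single)

lemma trm_power: "(trm e 1) ^ n = (trm (\<Sum>i<n. e) 1 :: 'k::comm_monoid_add \<Rightarrow>\<^sub>0 'a::comm_semiring_1)"
  using prod_trm[of "\<lambda>_. e" "{..<n}"] by simp

definition subst_exp :: "('v \<Rightarrow> ('w \<Rightarrow>\<^sub>0 nat)) \<Rightarrow> ('v \<Rightarrow>\<^sub>0 nat) \<Rightarrow> ('w \<Rightarrow>\<^sub>0 nat)" where
  "subst_exp e \<nu> = (\<Sum>k\<in>supp \<nu>. \<Sum>i<coef \<nu> k. e k)"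

lemma lookup_subst_exp: "coef (subst_exp e \<nu>) x = (\<Sum>k\<in>supp \<nu>. coef \<nu> k * coef (e k) x)"
  by (simp add: subst_exp_def lookup_sum)

lemma msubst_push:
  assumes "\<And>k. \<sigma> k = trm (e k) 1"
  shows "msubst \<sigma> f = push (subst_exp e) f"
  by (simp add: msubst_def push_def assms trm_power prod_trm mconst_def mult_single subst_exp_def)

definition texp :: "(nat \<Rightarrow> int^'n) \<Rightarrow> nat \<Rightarrow> 'n::finite \<Rightarrow> ('n + nat \<times> bool \<Rightarrow>\<^sub>0 nat)" where
  "texp u l k = trm (Inl k) 1 +
     (\<Sum>j<l. if u j $ k \<ge> 0 then trm (Inr (j, True)) (nat (u j $ k)) else trm (Inr (j, False)) (nat (- u j $ k)))"

lemma tvar_texp: "tvar u l k = trm (texp u l k) 1"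
proof -
  have "(\<Prod>j<l. if u j $ k \<ge> 0 then mvar (Inr (j, True)) ^ nat (u j $ k)
             else mvar (Inr (j, False)) ^ nat (- u j $ k)) =
     (trm (\<Sum>j<l. if u j $ k \<ge> 0 then trm (Inr (j, True)) (nat (u j $ k)) else trm (Inr (j, False)) (nat (- u j $ k))) 1
       :: ('a + nat \<times> bool, 'b) mpoly)"
    unfolding prod_trm[symmetric] by (intro prod.cong) (auto simp: mvar_power)
  then show ?thesis by (simp add: tvar_def texp_def mvar_def mult_single)
qed

lemma lookup_texp:
  fixes u :: "nat \<Rightarrow> int^'n::finite"
  shows "coef (texp u l k) (Inl k') = (if k = k' then 1 else 0)"
  "coef (texp u l k) (Inr (j, True)) = (if j < l then nat (u j $ k) else 0)"
  "coef (texp u l k) (Inr (j, False)) = (if j < l then nat (- u j $ k) else 0)"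
proof -
  have 0: "coef (if P then trm a x else trm b y) z = (if P then (x when a = z) else (y when b = z))"
    for P a b z and x y :: nat by (simp add: lookup_single)
  show "coef (texp u l k) (Inl k') = (if k = k' then 1 else 0)"
    by (auto simp: texp_def lookup_add lookup_sum 0 when_def lookup_single intro!: sum.neutral)
  have "coef (texp u l k) (Inr (j, True)) = (\<Sum>i<l. if u i $ k \<ge> 0
      then (nat (u i $ k) when Inr (i, True) = (Inr (j, True) :: 'n + nat \<times> bool))
      else (nat (- u i $ k) when Inr (i, False) = (Inr (j, True) :: 'n + nat \<times> bool)))"
    unfolding texp_def lookup_add lookup_sum 0 by (simp add: lookup_single)
  also have "\<dots> = (\<Sum>i<l. if i = j then nat (u j $ k) else 0)"
    by (rule sum.cong) (auto simp: when_def)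
  finally show "coef (texp u l k) (Inr (j, True)) = (if j < l then nat (u j $ k) else 0)" by simp
  have "coef (texp u l k) (Inr (j, False)) = (\<Sum>i<l. if u i $ k \<ge> 0
      then (nat (u i $ k) when Inr (i, True) = (Inr (j, False) :: 'n + nat \<times> bool))
      else (nat (- u i $ k) when Inr (i, False) = (Inr (j, False) :: 'n + nat \<times> bool)))"
    unfolding texp_def lookup_add lookup_sum 0 by (simp add: lookup_single)
  also have "\<dots> = (\<Sum>i<l. if i = j then nat (- u j $ k) else 0)"
    by (rule sum.cong) (auto simp: when_def)
  finally show "coef (texp u l k) (Inr (j, False)) = (if j < l then nat (- u j $ k) else 0)" by simp
qed

definition xpart :: "('n + nat \<times> bool \<Rightarrow>\<^sub>0 nat) \<Rightarrow> ('n \<Rightarrow>\<^sub>0 nat)" where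
  "xpart m = Poly_Mapping.map_key Inl m"

lemma lookup_xpart: "coef (xpart m) k = coef m (Inl k)"
  by (simp add: xpart_def map_key.rep_eq)

lemma xpart_add: "xpart (m + m') = xpart m + xpart m'"
  by (rule poly_mapping_eqI) (simp add: lookup_xpart lookup_add)

text \<open>Exponent of \<open>\<lambda>_j\<close> after putting
  \<open>\<mu>_j = 1 / \<lambda>_j\<close>.\<close>

definition ldeg :: "nat \<Rightarrow> ('n + nat \<times> bool \<Rightarrow>\<^sub>0 nat) \<Rightarrow> int" where
  "ldeg j m = int (coef m (Inr (j, True))) - int (coef m (Inr (j, False)))"

lemma ldeg_add: "ldeg j (m + m') = ldeg j m + ldeg j m'"
  by (simp add: ldeg_def lookup_add)

abbreviation "twist_exp u l \<equiv> subst_exp (texp u l)"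
definition embed_exp :: "('n \<Rightarrow>\<^sub>0 nat) \<Rightarrow> ('n + nat \<times> bool \<Rightarrow>\<^sub>0 nat)" where
  "embed_exp = subst_exp (\<lambda>k. trm (Inl k) 1)"

lemma xpart_subst: "xpart (twist_exp u l \<nu>) = \<nu>" "xpart (embed_exp \<nu>) = \<nu>"
proof -
  have *: "(\<Sum>k\<in>supp \<nu>. coef \<nu> k * (if k = k' then 1 else 0)) = coef \<nu> k'" for k'
    using sum.delta[of "supp \<nu>" k' "coef \<nu>"] by (simp add: in_keys_iff if_distrib cong: if_cong)
  show "xpart (twist_exp u l \<nu>) = \<nu>"
    by (rule poly_mapping_eqI) (simp only: lookup_xpart lookup_subst_exp lookup_texp *)
  have "coef (trm (Inl k :: 'a + nat \<times> bool) (1::nat)) (Inl k') = (if k = k' then 1 else 0)" for k k'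
    by (simp add: lookup_single when_def)
  then show "xpart (embed_exp \<nu>) = \<nu>"
    by (intro poly_mapping_eqI) (simp only: lookup_xpart lookup_subst_exp embed_exp_def *)
qed

text \<open>With \<open>\<mu>_j\<close> inverse to \<open>\<lambda>_j\<close>, \<open>t_k\<close> is
  \<open>x_k\<close> times the powers \<open>\<lambda>_j ^ (u j $ k)\<close>, so the twist records
  the \<open>u j\<close>-weight of an exponent as its \<open>\<lambda>_j\<close>-degree.\<close>

lemma ldeg_subst: "j < l \<Longrightarrow> ldeg j (twist_exp u l \<nu>) = udeg (u j) \<nu>" "ldeg j (embed_exp \<nu>) = 0"
proof -
  assume j: "j < l"
  have "ldeg j (twist_exp u l \<nu>) = (\<Sum>k\<in>supp \<nu>. u j $ k * int (coef \<nu> k))"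
    unfolding ldeg_def lookup_subst_exp lookup_texp of_nat_sum sum_subtractf[symmetric]
    by (rule sum.cong) (auto simp: j algebra_simps)
  also have "\<dots> = udeg (u j) \<nu>"
    unfolding udeg_def by (rule sum.mono_neutral_left) (auto simp: in_keys_iff)
  finally show "ldeg j (twist_exp u l \<nu>) = udeg (u j) \<nu>" .
next
  show "ldeg j (embed_exp \<nu>) = 0"
    by (simp add: ldeg_def embed_exp_def lookup_subst_exp lookup_single)
qed

text \<open>Undoes the substitution \<open>x\<^sub>k \<mapsto> t\<^sub>k\<close> after \<open>\<mu>\<^sub>j = 1 / \<lambda>\<^sub>j\<close>, and extracts the coefficient of
  \<open>\<lambda>\<^sup>-\<^sup>w\<close>, a polynomial in \<open>x\<close>.\<close>
definition untwist :: "(nat \<Rightarrow> int^'n) \<Rightarrow> nat \<Rightarrow> (nat \<Rightarrow> int) \<Rightarrow> ('n::finite + nat \<times> bool, 'a::comm_ring_1) mpoly \<Rightarrow> ('n, 'a) mpoly" where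
  "untwist u l w h = push xpart (filt (\<lambda>m. \<forall>j<l. ldeg j m - udeg (u j) (xpart m) = - w j) h)"

text \<open>Multiplying by a term shifts the index \<open>w\<close>; this is why the memberships
  below are proved for all \<open>w\<close> at once.\<close>

lemma untwist_simps:
  "untwist u l w 0 = 0"
  "untwist u l w (f + g) = untwist u l w f + untwist u l w g"
  "untwist u l w (f - g) = untwist u l w f - untwist u l w g"
  "untwist u l w (trm \<alpha> c * f) = trm (xpart \<alpha>) c * untwist u l (\<lambda>j. w j + (ldeg j \<alpha> - udeg (u j) (xpart \<alpha>))) f"
proof -
  have eq: "(ldeg j (\<alpha> + m) - udeg (u j) (xpart (\<alpha> + m)) = - w j) \<longleftrightarrow>
      (ldeg j m - udeg (u j) (xpart m) = - (w j + (ldeg j \<alpha> - udeg (u j) (xpart \<alpha>))))" for j m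
    by (auto simp: ldeg_add xpart_add udeg_add)
  show "untwist u l w (trm \<alpha> c * f) = trm (xpart \<alpha>) c * untwist u l (\<lambda>j. w j + (ldeg j \<alpha> - udeg (u j) (xpart \<alpha>))) f"
    unfolding untwist_def filt_trm_mult eq by (rule push_trm_mult) (rule xpart_add)
qed (simp_all add: untwist_def filt_add filt_minus push_add push_diff)

lemma untwist_tau: "untwist u l w (push (twist_exp u l) f) = (if \<forall>j<l. w j = 0 then f else 0)"
proof -
  have eq: "(\<forall>j<l. ldeg j (twist_exp u l \<nu>) - udeg (u j) \<nu> = - w j) \<longleftrightarrow> (\<forall>j<l. w j = 0)" for \<nu>
    by (auto simp: ldeg_subst)
  have "untwist u l w (push (twist_exp u l) f) = filt (\<lambda>_. \<forall>j<l. w j = 0) f"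
    unfolding untwist_def filt_push push_push xpart_subst push_id eq ..
  then show ?thesis by (auto simp: filt_self filt_none)
qed

text \<open>Untwisting a monomial in \<open>x\<close> alone leaves \<open>\<lambda>\<close> to the
  power of minus its weight; the sign in \<open>untwist\<close> makes index \<open>w\<close> return
  the component of weight \<open>w\<close>.\<close>

lemma untwist_iota: "untwist u l w (push embed_exp g) = filt (\<lambda>\<nu>. \<forall>j<l. udeg (u j) \<nu> = w j) g"
  by (simp add: untwist_def filt_push push_push xpart_subst push_id ldeg_subst)

text \<open>The \<open>h\<close> all of whose untwisted coefficients lie in \<open>I\<close> form an
  ideal containing the generators: a twisted \<open>f\<close> goes to \<open>f\<close> or to
  zero.\<close>

lemma untwist_J0:
  assumes I: "is_ideal_set I" and h: "h \<in> J0 I u l"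
  shows "untwist u l w h \<in> I"
proof -
  have "J0 I u l \<subseteq> {h. \<forall>w. untwist u l w h \<in> I}"
    unfolding J0_def
  proof (rule gen_ideal_least)
    show "is_ideal_set {h. \<forall>w. untwist u l w h \<in> I}"
      by (rule is_ideal_setI_trm) (use is_ideal_setD[OF I] in \<open>auto simp: untwist_simps\<close>)
    show "msubst (tvar u l) ` I \<subseteq> {h. \<forall>w. untwist u l w h \<in> I}"
      using is_ideal_setD(1)[OF I] by (auto simp: msubst_push[OF tvar_texp] untwist_tau)
  qed
  then show ?thesis using h by auto
qed

text \<open>Exponent of \<open>(\<lambda>_j \<mu>_j)^n\<close>.\<close>

definition lm_exp :: "nat \<Rightarrow> nat \<Rightarrow> ('n + nat \<times> bool \<Rightarrow>\<^sub>0 nat)" where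
  "lm_exp j n = trm (Inr (j, True)) n + trm (Inr (j, False)) n"

lemma Wideal_gen: "mvar (Inr (i, True)) * mvar (Inr (i, False)) - 1 = trm (lm_exp i 1) 1 - trm 0 1"
  by (simp add: mvar_def mult_single lm_exp_def)

text \<open>Both terms of a generator have trivial \<open>x\<close>-part and
  \<open>\<lambda>\<close>-degree zero, so their images cancel.\<close>

lemma untwist_Wideal:
  assumes "h \<in> Wideal l"
  shows "untwist u l w h = 0"
proof -
  have "Wideal l \<subseteq> {h. \<forall>w. untwist u l w h = 0}"
    unfolding Wideal_def
  proof (rule gen_ideal_least)
    show "is_ideal_set {h. \<forall>w. untwist u l w h = 0}"
      by (rule is_ideal_setI_trm) (auto simp: untwist_simps)
    have x: "xpart (lm_exp i n) = 0" "xpart 0 = 0" for i n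
      by (auto intro!: poly_mapping_eqI simp: lookup_xpart lm_exp_def lookup_add lookup_single)
    have d: "ldeg j (lm_exp i n) = 0" "ldeg j 0 = 0" for i j n
      by (auto simp: ldeg_def lm_exp_def lookup_add lookup_single when_def)
    show "(\<lambda>i. mvar (Inr (i, True)) * mvar (Inr (i, False)) - 1) ` {..<l} \<subseteq> {h. \<forall>w. untwist u l w h = 0}"
      unfolding Wideal_gen by (auto simp: untwist_def filt_minus filt_trm push_diff push_trm x d simp del: single_one)
  qed
  then show ?thesis using assms by auto
qed

text \<open>The factors \<open>(\<lambda>_j \<mu>_j)^(n j)\<close> are stripped one at a time; the
  differences telescope inside the ideal.\<close>

lemma Wideal_reduce:
  fixes c :: "'a::comm_ring_1" and \<alpha> :: "'n::finite + nat \<times> bool \<Rightarrow>\<^sub>0 nat"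
  assumes "finite A" "A \<subseteq> {..<l}"
  shows "trm (\<alpha> + (\<Sum>j\<in>A. lm_exp j (n j))) c - trm \<alpha> c \<in> Wideal l"
proof -
  have "is_ideal_set (Wideal l :: ('n + nat \<times> bool, 'a) mpoly set)"
    unfolding Wideal_def by (rule gen_ideal_is_ideal)
  note W = is_ideal_setD[OF this]
  have one: "trm (\<alpha> + lm_exp j n) c - trm \<alpha> c \<in> Wideal l"
    if j: "j < l" for j n and \<alpha> :: "'n + nat \<times> bool \<Rightarrow>\<^sub>0 nat"
  proof (induction n)
    case 0
    then show ?case using W(1) by (simp add: lm_exp_def)
  next
    case (Suc n)
    have e: "lm_exp j (Suc n) = lm_exp j n + (lm_exp j 1 :: 'n + nat \<times> bool \<Rightarrow>\<^sub>0 nat)"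
      by (rule poly_mapping_eqI) (simp add: lm_exp_def lookup_add lookup_single when_def)
    have "mvar (Inr (j, True)) * mvar (Inr (j, False)) - 1 \<in> (Wideal l :: ('n + nat \<times> bool, 'a) mpoly set)"
      unfolding Wideal_def using j by (intro subsetD[OF gen_ideal_superset] imageI) simp
    then have "trm (lm_exp j 1) 1 - trm 0 1 \<in> (Wideal l :: ('n + nat \<times> bool, 'a) mpoly set)"
      by (simp only: Wideal_gen)
    from W(3)[OF this, of "trm (\<alpha> + lm_exp j n) c"]
    have "trm (\<alpha> + lm_exp j (Suc n)) c - trm (\<alpha> + lm_exp j n) c \<in> Wideal l"
      by (simp add: right_diff_distrib mult_single e add.assoc)
    from W(2)[OF this Suc] show ?case by simp
  qed
  show ?thesis
    using assms
  proof (induction A rule: finite_induct)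
    case empty
    then show ?case using W(1) by simp
  next
    case (insert j A)
    have "trm (\<alpha> + (\<Sum>j\<in>A. lm_exp j (n j)) + lm_exp j (n j)) c - trm (\<alpha> + (\<Sum>j\<in>A. lm_exp j (n j))) c \<in> Wideal l"
      using insert.prems by (intro one) auto
    from W(2)[OF this insert.IH] insert show ?case by (simp add: add_ac)
  qed
qed

text \<open>If \<open>g\<close> has pure weight \<open>w\<close>, twisting multiplies it by
  \<open>\<lambda>^w\<close> modulo the relations; a monomial representing the inverse power brings
  it back to \<open>g\<close>.\<close>

lemma homogeneous_in_J0_tilde:
  fixes g :: "('n::finite, 'a::comm_ring_1) mpoly"
  assumes "g \<in> I" and w: "\<And>\<nu> j. \<nu> \<in> supp g \<Longrightarrow> j < l \<Longrightarrow> udeg (u j) \<nu> = w j"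
  shows "g \<in> J0_tilde I u l"
proof -
  \<comment> \<open>Represents \<open>\<lambda>^(-w)\<close> with natural exponents:
    \<open>\<mu>_j\<close> takes over where \<open>w j\<close> is positive.\<close>
  define \<beta> :: "'n + nat \<times> bool \<Rightarrow>\<^sub>0 nat" where
    "\<beta> = (\<Sum>j<l. trm (Inr (j, True)) (nat (- w j)) + trm (Inr (j, False)) (nat (w j)))"
  have \<beta>: "coef \<beta> (Inl k) = 0" "coef \<beta> (Inr (j, True)) = (if j < l then nat (- w j) else 0)"
    "coef \<beta> (Inr (j, False)) = (if j < l then nat (w j) else 0)" for k j
    by (simp_all add: \<beta>_def lookup_sum lookup_add lookup_single when_def)
  define h where "h = trm \<beta> 1 * msubst (tvar u l) g"
  have "msubst (tvar u l) g \<in> J0 I u l" unfolding J0_def using assms(1) by (intro subsetD[OF gen_ideal_superset] imageI)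
  then have hJ: "h \<in> J0 I u l"
    unfolding h_def J0_def by (rule is_ideal_setD(3)[OF gen_ideal_is_ideal])
  have hs: "h = (\<Sum>\<nu>\<in>supp g. trm (\<beta> + twist_exp u l \<nu>) (coef g \<nu>))"
    by (simp add: h_def msubst_push[OF tvar_texp] push_def sum_distrib_left mult_single)
  have term_in_W: "trm (\<beta> + twist_exp u l \<nu>) c - trm (embed_exp \<nu>) c \<in> Wideal l" if \<nu>: "\<nu> \<in> supp g" for \<nu> and c :: 'a
  proof -
    \<comment> \<open>Homogeneity makes the exponents of \<open>\<lambda>_j\<close> and
      \<open>\<mu>_j\<close> agree once \<open>\<beta>\<close> is added; \<open>n j\<close> is their
      common value, zero from \<open>l\<close> on.\<close>
    define n where "n j = coef (\<beta> + twist_exp u l \<nu>) (Inr (j, True))" for j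
    have n: "coef (\<beta> + twist_exp u l \<nu>) (Inr (j, False)) = n j" for j
    proof (cases "j < l")
      case True
      have "ldeg j (twist_exp u l \<nu>) = w j" using ldeg_subst(1)[OF True, of u \<nu>] w[OF \<nu> True] by simp
      then show ?thesis using True by (auto simp: n_def lookup_add \<beta> ldeg_def)
    next
      case False
      then show ?thesis by (simp add: n_def lookup_add \<beta> lookup_subst_exp lookup_texp)
    qed
    have "\<beta> + twist_exp u l \<nu> = embed_exp \<nu> + (\<Sum>j<l. lm_exp j (n j))"
    proof (rule poly_mapping_eqI)
      fix x
      have s: "coef (\<Sum>j<l. lm_exp j (n j)) (Inr (j, b)) = (if j < l then n j else 0)" for j b
        by (cases b) (simp_all add: lookup_sum lm_exp_def lookup_add lookup_single when_def)
      have z: "n j = 0" if "\<not> j < l" for j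
        using that by (simp add: n_def lookup_add \<beta> lookup_subst_exp lookup_texp)
      show "coef (\<beta> + twist_exp u l \<nu>) x = coef (embed_exp \<nu> + (\<Sum>j<l. lm_exp j (n j))) x"
      proof (cases x)
        case (Inl k)
        have "coef (twist_exp u l \<nu>) (Inl k) = coef (embed_exp \<nu>) (Inl k)"
          by (simp flip: lookup_xpart add: xpart_subst)
        moreover have "coef (\<Sum>j<l. lm_exp j (n j)) (Inl k) = 0"
          by (simp add: lookup_sum lm_exp_def lookup_add lookup_single)
        ultimately show ?thesis using Inl by (simp add: lookup_add \<beta>)
      next
        case (Inr y)
        obtain j b where y: "y = (j, b)" by force
        have "coef (\<beta> + twist_exp u l \<nu>) (Inr (j, b)) = n j" using n by (cases b) (simp_all add: n_def)
        moreover have "coef (embed_exp \<nu>) (Inr (j, b)) = 0" by (simp add: embed_exp_def lookup_subst_exp lookup_single)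
        ultimately show ?thesis using Inr y z by (simp add: lookup_add[of "embed_exp \<nu>"] s)
      qed
    qed
    then show ?thesis using Wideal_reduce[of "{..<l}" l "embed_exp \<nu>" n c] by simp
  qed
  have embed_exp: "msubst (\<lambda>k. mvar (Inl k)) g = push embed_exp g"
    unfolding embed_exp_def by (rule msubst_push) (simp add: mvar_def)
  have "h - msubst (\<lambda>k. mvar (Inl k)) g = (\<Sum>\<nu>\<in>supp g. trm (\<beta> + twist_exp u l \<nu>) (coef g \<nu>) - trm (embed_exp \<nu>) (coef g \<nu>))"
    by (simp add: hs embed_exp push_def sum_subtractf)
  also have "\<dots> \<in> Wideal l"
    unfolding Wideal_def by (rule ideal_sum[OF gen_ideal_is_ideal]) (use term_in_W in \<open>simp add: Wideal_def\<close>)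
  finally show ?thesis using hJ by (auto simp: J0_tilde_def)
qed

text \<open>One inclusion applies \<open>untwist\<close> to the congruence of \<open>h\<close> and
  \<open>g\<close>; the other splits \<open>g\<close> into finitely many joint components, each
  homogeneous and in \<open>I\<close>.\<close>

lemma J0_tilde_eq_core:
  fixes I :: "('n::finite, 'a::comm_ring_1) mpoly set"
  assumes I: "is_ideal_set I"
  shows "J0_tilde I u l = core u l I"
proof (intro set_eqI iffI)
  have embed_exp: "msubst (\<lambda>k. mvar (Inl k)) g = push embed_exp g" for g :: "('n, 'a) mpoly"
    unfolding embed_exp_def by (rule msubst_push) (simp add: mvar_def)
  {
    fix g assume "g \<in> J0_tilde I u l"
    then obtain h where h: "h \<in> J0 I u l" "h - push embed_exp g \<in> Wideal l"
      by (auto simp: J0_tilde_def embed_exp)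
    have "filt (\<lambda>\<nu>. \<forall>j<l. udeg (u j) \<nu> = w j) g \<in> I" for w
      using untwist_J0[OF I h(1), of w] untwist_Wideal[OF h(2), of u w]
      by (simp add: untwist_simps untwist_iota)
    then show "g \<in> core u l I" by (simp add: core_def)
  next
    fix g assume g: "g \<in> core u l I"
    \<comment> \<open>Zero from \<open>l\<close> on, so that equality of functions means agreement
      of the first \<open>l\<close> weights.\<close>
    define d where "d \<nu> = (\<lambda>j. if j < l then udeg (u j) \<nu> else 0)" for \<nu>
    have add: "a + b \<in> J0_tilde I u l" if ab: "a \<in> J0_tilde I u l" "b \<in> J0_tilde I u l" for a b
    proof -
      obtain h h' where h: "h \<in> J0 I u l" "h - push embed_exp a \<in> Wideal l" "h' \<in> J0 I u l" "h' - push embed_exp b \<in> Wideal l"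
        using ab by (auto simp: J0_tilde_def embed_exp)
      have "h + h' \<in> J0 I u l"
        unfolding J0_def by (rule is_ideal_setD(2)[OF gen_ideal_is_ideal h(1,3)[unfolded J0_def]])
      moreover have "(h - push embed_exp a) + (h' - push embed_exp b) \<in> Wideal l"
        unfolding Wideal_def by (rule is_ideal_setD(2)[OF gen_ideal_is_ideal h(2,4)[unfolded Wideal_def]])
      ultimately show ?thesis unfolding J0_tilde_def embed_exp
        by (intro CollectI bexI[of _ "h + h'"]) (simp_all add: push_add algebra_simps)
    qed
    have zero: "0 \<in> J0_tilde I u l"
      by (rule homogeneous_in_J0_tilde) (use is_ideal_setD(1)[OF I] in auto)
    have "(\<Sum>w\<in>A. filt (\<lambda>\<nu>. d \<nu> = w) g) \<in> J0_tilde I u l" if "A \<subseteq> d ` supp g" for A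
      using finite_subset[OF that] that
    proof (induction A rule: infinite_finite_induct)
      case (insert w A)
      then have w: "\<And>j. \<not> j < l \<Longrightarrow> w j = 0" by (auto simp: d_def)
      then have "filt (\<lambda>\<nu>. d \<nu> = w) g = filt (\<lambda>\<nu>. \<forall>j<l. udeg (u j) \<nu> = w j) g"
        by (intro arg_cong[where f = "\<lambda>P. filt P g"]) (auto simp: d_def fun_eq_iff)
      then have "filt (\<lambda>\<nu>. d \<nu> = w) g \<in> I" using g by (simp add: core_def)
      then have "filt (\<lambda>\<nu>. d \<nu> = w) g \<in> J0_tilde I u l"
        by (rule homogeneous_in_J0_tilde[where w = w]) (auto simp: supp_filt d_def)
      then show ?case using insert add by auto
    qed (use zero in auto)
    from this[of "d ` supp g"] show "g \<in> J0_tilde I u l"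
      by (simp add: sum_filt_fibres)
  }
qed

subsection \<open>Elimination of the weight of \<open>u\<close>\<close>

text \<open>Error terms dominated by a monomial of \<open>u\<close>-weight \<open>s\<close> and
  \<open>\<omega>\<close>-weight \<open>t\<close>; zero always qualifies.\<close>

definition above :: "int^'n \<Rightarrow> real^'n \<Rightarrow> int \<Rightarrow> real \<Rightarrow> ('n::finite, 'a::comm_ring_1) mpoly set" where
  "above u \<omega> s t = {f. \<forall>\<mu>\<in>supp f. udeg u \<mu> = s \<and> t < wdot \<omega> \<mu>}"

lemma above_add: "f \<in> above u \<omega> s t \<Longrightarrow> g \<in> above u \<omega> s t \<Longrightarrow> f + g \<in> above u \<omega> s t"
  using keys_add[of f g] unfolding above_def by blast

lemma above_uminus: "f \<in> above u \<omega> s t \<Longrightarrow> - f \<in> above u \<omega> s t"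
  by (simp add: above_def in_keys_iff)

lemma above_diff: "f \<in> above u \<omega> s t \<Longrightarrow> g \<in> above u \<omega> s t \<Longrightarrow> f - g \<in> above u \<omega> s t"
  using above_add[of f u \<omega> s t "- g"] above_uminus[of g u \<omega> s t] by simp

lemma above_mult: "f \<in> above u \<omega> s t \<Longrightarrow> g \<in> above u \<omega> s' t' \<Longrightarrow> f * g \<in> above u \<omega> (s + s') (t + t')"
  using keys_mult[of f g] unfolding above_def by (fastforce simp: udeg_add wdot_add)

lemma above_trm_mult: "f \<in> above u \<omega> s t \<Longrightarrow> trm \<nu> 1 * f \<in> above u \<omega> (udeg u \<nu> + s) (wdot \<omega> \<nu> + t)"
  using keys_mult[of "trm \<nu> 1" f] unfolding above_def by (fastforce simp: udeg_add wdot_add)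

text \<open>Fraction-free Gaussian elimination. Row operations keep the row sums in
  \<open>I\<close>, and the shifts \<open>r - q\<close> and \<open>\<phi> r - \<phi> q\<close>
  telescope, so the diagonal stays dominant. When one index is left, the row sum is the diagonal
  entry itself.\<close>

lemma elimination:
  fixes A :: "int \<Rightarrow> int \<Rightarrow> ('n::finite, 'a::comm_ring_1) mpoly" and \<phi> :: "int \<Rightarrow> real"
  assumes "finite P" "P \<noteq> {}" and I: "is_ideal_set I"
    and "\<And>q. q \<in> P \<Longrightarrow> (\<Sum>r\<in>P. A q r) \<in> I"
    and "\<And>q r. q \<in> P \<Longrightarrow> r \<in> P \<Longrightarrow> q \<noteq> r \<Longrightarrow>
      A q r \<in> above u \<omega> (udeg u (N q) + (r - q)) (wdot \<omega> (N q) + (\<phi> r - \<phi> q))"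
    and "\<And>q. q \<in> P \<Longrightarrow> A q q - trm (N q) 1 \<in> above u \<omega> (udeg u (N q)) (wdot \<omega> (N q))"
  shows "\<exists>M g. g \<in> I \<and> g - trm M 1 \<in> above u \<omega> (udeg u M) (wdot \<omega> M)"
  using assms(1,2,4-)
proof (induction P arbitrary: A N rule: finite_ne_induct)
  case (singleton p)
  from singleton(1)[of p] singleton(3)[of p] show ?case by auto
next
  case (insert p P)
  note off = insert.prems(2) and diag = insert.prems(3)
  \<comment> \<open>Pivot on \<open>A p p\<close>; the column of \<open>p\<close> vanishes and is
    dropped.\<close>
  define B where "B q r = A p p * A q r - A q p * A p r" for q r
  define R where "R q = (\<Sum>r\<in>insert p P. A q r)" for q
  have R: "R q \<in> I" if "q \<in> insert p P" for q using insert.prems(1)[OF that] by (simp add: R_def)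
  have sumA: "(\<Sum>r\<in>P. A q r) = R q - A q p" for q
    using insert.hyps by (simp add: R_def)
  \<comment> \<open>The detour from \<open>q\<close> via \<open>p\<close> to \<open>r\<close> has
    the same total shift as the direct step.\<close>
  have pr: "A q p * A p r \<in> above u \<omega> (udeg u (N p + N q) + (r - q)) (wdot \<omega> (N p + N q) + (\<phi> r - \<phi> q))"
    if "q \<in> P" "r \<in> P" for q r
  proof -
    have "q \<noteq> p" "r \<noteq> p" using that insert.hyps by auto
    then have "A q p * A p r \<in> above u \<omega> (udeg u (N q) + (p - q) + (udeg u (N p) + (r - p)))
      (wdot \<omega> (N q) + (\<phi> p - \<phi> q) + (wdot \<omega> (N p) + (\<phi> r - \<phi> p)))"
      using that by (intro above_mult off) auto
    then show ?thesis by (simp add: udeg_add wdot_add algebra_simps)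
  qed
  define E where "E = A p p - trm (N p) 1"
  have App: "A p p = trm (N p) 1 + E" by (simp add: E_def)
  have E: "E \<in> above u \<omega> (udeg u (N p)) (wdot \<omega> (N p))" using diag[of p] by (simp add: E_def)
  show ?case
  proof (rule insert.IH[of B "\<lambda>q. N p + N q"])
    fix q assume q: "q \<in> P"
    have "(\<Sum>r\<in>P. B q r) = A p p * (\<Sum>r\<in>P. A q r) - A q p * (\<Sum>r\<in>P. A p r)"
      by (simp add: B_def sum_subtractf sum_distrib_left)
    \<comment> \<open>Both sums omit column \<open>p\<close>; the omitted contributions
      cancel.\<close>
    also have "\<dots> = A p p * R q - A q p * R p"
      by (simp add: sumA algebra_simps)
    finally show "(\<Sum>r\<in>P. B q r) \<in> I"
      using R q is_ideal_setD[OF I] by simp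
    define F where "F = A q q - trm (N q) 1"
    have Aqq: "A q q = trm (N q) 1 + F" by (simp add: F_def)
    have F: "F \<in> above u \<omega> (udeg u (N q)) (wdot \<omega> (N q))" using diag[of q] q by (simp add: F_def)
    have "B q q - trm (N p + N q) 1 = trm (N p) 1 * F + trm (N q) 1 * E + E * F - A q p * A p q"
      by (simp add: B_def App Aqq algebra_simps mult_single)
    moreover have "trm (N p) 1 * F \<in> above u \<omega> (udeg u (N p + N q)) (wdot \<omega> (N p + N q))"
      using above_trm_mult[OF F] by (simp add: udeg_add wdot_add)
    moreover have "trm (N q) 1 * E \<in> above u \<omega> (udeg u (N p + N q)) (wdot \<omega> (N p + N q))"
      using above_trm_mult[OF E, of "N q"] by (simp add: udeg_add wdot_add add.commute)
    moreover have "E * F \<in> above u \<omega> (udeg u (N p + N q)) (wdot \<omega> (N p + N q))"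
      using above_mult[OF E F] by (simp add: udeg_add wdot_add)
    moreover have "A q p * A p q \<in> above u \<omega> (udeg u (N p + N q)) (wdot \<omega> (N p + N q))"
      using pr[OF q q] by simp
    ultimately show "B q q - trm (N p + N q) 1 \<in> above u \<omega> (udeg u (N p + N q)) (wdot \<omega> (N p + N q))"
      by (simp only:) (intro above_add above_diff)
  next
    fix q r assume qr: "q \<in> P" "r \<in> P" "q \<noteq> r"
    let ?S = "above u \<omega> (udeg u (N p + N q) + (r - q)) (wdot \<omega> (N p + N q) + (\<phi> r - \<phi> q))"
    have Aqr: "A q r \<in> above u \<omega> (udeg u (N q) + (r - q)) (wdot \<omega> (N q) + (\<phi> r - \<phi> q))"
      using qr by (intro off) auto
    have "B q r = trm (N p) 1 * A q r + E * A q r - A q p * A p r"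
      by (simp add: B_def App algebra_simps)
    moreover have "trm (N p) 1 * A q r \<in> ?S"
      using above_trm_mult[OF Aqr, of "N p"] by (simp add: udeg_add wdot_add add.assoc)
    moreover have "E * A q r \<in> ?S"
      using above_mult[OF E Aqr] by (simp add: udeg_add wdot_add add.assoc)
    ultimately show "B q r \<in> ?S"
      using pr[OF qr(1,2)] by (simp only:) (intro above_add above_diff)
  qed
qed

lemma lead_above:
  fixes g :: "('n::finite, 'a::comm_ring_1) mpoly"
  assumes "g - trm M 1 \<in> above u \<omega> (udeg u M) (wdot \<omega> M)"
  shows "lead (wdot \<omega>) M g" "\<And>\<mu>. \<mu> \<in> supp g \<Longrightarrow> udeg u \<mu> = udeg u M"
proof -
  have *: "\<mu> \<in> supp (g - trm M 1)" if "\<mu> \<in> supp g" "\<mu> \<noteq> M" for \<mu>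
    using that by (simp add: in_keys_iff lookup_minus lookup_single_not_eq)
  have "M \<notin> supp (g - trm M 1)" using assms by (auto simp: above_def)
  then have "M \<in> supp g" by (auto simp: in_keys_iff lookup_minus)
  then show "lead (wdot \<omega>) M g" using * assms by (auto simp: lead_def above_def)
  show "udeg u \<mu> = udeg u M" if "\<mu> \<in> supp g" for \<mu>
    using *[OF that] assms by (cases "\<mu> = M") (auto simp: above_def)
qed

text \<open>The hypothesis is a winning strategy in the following game: in position \<open>p\<close>, standing for
  multiples of a monomial of relative \<open>u\<close>-weight \<open>p\<close>, one replaces this monomial by the
  remaining terms of an element of the ideal. Steering with \<open>v = - \<epsilon> p\<close> keeps the positions
  bounded while \<open>\<omega>\<close>-weight minus the potential \<open>\<epsilon> p\<^sup>2 / 2\<close> increases.\<close>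
lemma steering:
  fixes T :: "(('n::finite, 'a::field) mpoly \<times> ('n \<Rightarrow>\<^sub>0 nat)) set" and \<delta> V :: real
  assumes I: "is_ideal_set I" and fin: "finite T" and \<delta>: "\<delta> > 0"
    and T: "\<And>f \<nu>. (f, \<nu>) \<in> T \<Longrightarrow> f \<in> I \<and> \<nu> \<in> supp f"
    and cover: "\<And>v :: real. \<exists>(f, \<nu>)\<in>T. \<forall>\<mu>\<in>supp f. \<mu> \<noteq> \<nu> \<longrightarrow>
      \<delta> \<le> (wdot \<omega> \<mu> - wdot \<omega> \<nu>) + v * (udeg u \<mu> - udeg u \<nu>) \<and>
      (v \<ge> V \<longrightarrow> udeg u \<nu> \<le> udeg u \<mu>) \<and> (v \<le> - V \<longrightarrow> udeg u \<mu> \<le> udeg u \<nu>)"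
  shows "\<exists>g\<in>core1 u I. \<exists>M. lead (wdot \<omega>) M g"
proof -
  \<comment> \<open>All jumps of the \<open>u\<close>-weight; the inserted \<open>1\<close> keeps
    their bound \<open>K\<close> positive.\<close>
  define S where "S = (\<Union>(f, \<nu>)\<in>T. (\<lambda>\<mu>. \<bar>udeg u \<mu> - udeg u \<nu>\<bar>) ` supp f)"
  have "finite S" using fin by (auto simp: S_def)
  define K where "K = Max (insert 1 S)"
  have K1: "K \<ge> 1" and K: "\<And>f \<nu> \<mu>. (f, \<nu>) \<in> T \<Longrightarrow> \<mu> \<in> supp f \<Longrightarrow> \<bar>udeg u \<mu> - udeg u \<nu>\<bar> \<le> K"
    using \<open>finite S\<close> by (auto simp: K_def S_def intro!: Max_ge)
  \<comment> \<open>Gives \<open>\<epsilon> * K^2 = \<delta>\<close>: the second-order term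
    \<open>\<epsilon> * d^2 / 2\<close> of the potential then costs at most half the margin.\<close>
  define \<epsilon> where "\<epsilon> = \<delta> / (real_of_int K)\<^sup>2"
  have \<epsilon>: "\<epsilon> > 0" using \<delta> K1 by (simp add: \<epsilon>_def)
  \<comment> \<open>Positions beyond \<open>\<rho> - K\<close> in absolute value steer with
    \<open>v\<close> of absolute value at least \<open>\<bar>V\<bar>\<close>, where
    \<open>cover\<close> forbids outward jumps.\<close>
  define \<rho> where "\<rho> = \<lceil>\<bar>V\<bar> / \<epsilon>\<rceil> + K"
  have \<rho>: "\<bar>V\<bar> \<le> \<epsilon> * (\<rho> - K)"
  proof -
    have "\<bar>V\<bar> / \<epsilon> \<le> \<rho> - K" by (simp add: \<rho>_def)
    then show ?thesis using \<epsilon> by (simp add: field_simps)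
  qed
  have "0 \<le> \<bar>V\<bar> / \<epsilon>" using \<epsilon> by simp
  \<comment> \<open>Prevents an inward jump from overshooting the opposite end.\<close>
  then have \<rho>0: "\<rho> \<ge> K" unfolding \<rho>_def by linarith
  define P where "P = {-\<rho>..\<rho>}"
  define \<phi> where "\<phi> p = \<epsilon> / 2 * (real_of_int p)\<^sup>2" for p :: int
  have "\<exists>f \<nu>. (f, \<nu>) \<in> T \<and> (\<forall>\<mu>\<in>supp f. \<mu> \<noteq> \<nu> \<longrightarrow>
      \<phi> (p + (udeg u \<mu> - udeg u \<nu>)) - \<phi> p < wdot \<omega> \<mu> - wdot \<omega> \<nu> \<and> p + (udeg u \<mu> - udeg u \<nu>) \<in> P)"
    if p: "p \<in> P" for p
  proof -
    obtain f \<nu> where f: "(f, \<nu>) \<in> T" and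
      c: "\<And>\<mu>. \<mu> \<in> supp f \<Longrightarrow> \<mu> \<noteq> \<nu> \<Longrightarrow> \<delta> \<le> (wdot \<omega> \<mu> - wdot \<omega> \<nu>) + (- \<epsilon> * p) * (udeg u \<mu> - udeg u \<nu>) \<and>
      (- \<epsilon> * p \<ge> V \<longrightarrow> udeg u \<nu> \<le> udeg u \<mu>) \<and> (- \<epsilon> * p \<le> - V \<longrightarrow> udeg u \<mu> \<le> udeg u \<nu>)"
      using cover[of "- \<epsilon> * p"] by blast
    show ?thesis
    proof (intro exI conjI ballI impI)
      fix \<mu> assume \<mu>: "\<mu> \<in> supp f" "\<mu> \<noteq> \<nu>"
      define d where "d = udeg u \<mu> - udeg u \<nu>"
      have dK: "\<bar>d\<bar> \<le> K" using K[OF f \<mu>(1)] by (simp add: d_def)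
      then have "(real_of_int d)\<^sup>2 \<le> (real_of_int K)\<^sup>2"
        using K1 by (intro abs_le_square_iff[THEN iffD1]) linarith
      then have "\<epsilon> * (real_of_int d)\<^sup>2 \<le> \<epsilon> * (real_of_int K)\<^sup>2"
        using \<epsilon> by (intro mult_left_mono) auto
      also have "\<dots> = \<delta>" using K1 by (simp add: \<epsilon>_def)
      finally have *: "\<epsilon> * (real_of_int d)\<^sup>2 \<le> \<delta>" .
      \<comment> \<open>The linear term is exactly what the steering value
        \<open>v = - \<epsilon> * p\<close> compensates.\<close>
      have "\<phi> (p + d) - \<phi> p = \<epsilon> * p * d + \<epsilon> * (real_of_int d)\<^sup>2 / 2"
        by (simp add: \<phi>_def power2_eq_square algebra_simps)
      also have "\<dots> < \<epsilon> * p * d + \<delta>"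
        using * \<delta> by simp
      also have "\<dots> \<le> wdot \<omega> \<mu> - wdot \<omega> \<nu>"
        using c[OF \<mu>] by (simp add: d_def)
      finally show "\<phi> (p + (udeg u \<mu> - udeg u \<nu>)) - \<phi> p < wdot \<omega> \<mu> - wdot \<omega> \<nu>" by (simp add: d_def)
      have 1: "d \<le> 0" if "p > \<rho> - K"
      proof -
        have "\<epsilon> * (\<rho> - K) \<le> \<epsilon> * p"
          using that \<epsilon> by (intro mult_left_mono) auto
        then have "- \<epsilon> * p \<le> - V" using \<rho> by linarith
        then show ?thesis using c[OF \<mu>] by (simp add: d_def)
      qed
      have 2: "d \<ge> 0" if "p < -(\<rho> - K)"
      proof -
        have "\<epsilon> * (\<rho> - K) \<le> \<epsilon> * (- p)"
          using that \<epsilon> by (intro mult_left_mono) auto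
        then have "- \<epsilon> * p \<ge> V" using \<rho> by linarith
        then show ?thesis using c[OF \<mu>] by (simp add: d_def)
      qed
      show "p + (udeg u \<mu> - udeg u \<nu>) \<in> P"
        using 1 2 dK p \<rho>0 unfolding d_def[symmetric] P_def atLeastAtMost_iff by linarith
    qed (rule f)
  qed
  then obtain f N where fN: "\<And>p. p \<in> P \<Longrightarrow> (f p, N p) \<in> T"
    and step: "\<And>p \<mu>. p \<in> P \<Longrightarrow> \<mu> \<in> supp (f p) \<Longrightarrow> \<mu> \<noteq> N p \<Longrightarrow>
      \<phi> (p + (udeg u \<mu> - udeg u (N p))) - \<phi> p < wdot \<omega> \<mu> - wdot \<omega> (N p) \<and> p + (udeg u \<mu> - udeg u (N p)) \<in> P"
    by metis
  define F where "F p = trm 0 (inverse (coef (f p) (N p))) * f p" for p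
  have cF: "coef (F p) \<mu> = inverse (coef (f p) (N p)) * coef (f p) \<mu>" for p \<mu>
    using lookup_trm_mult[of 0 _ "f p" \<mu>] by (simp add: F_def)
  have FI: "F p \<in> I" if "p \<in> P" for p
    using T fN[OF that] is_ideal_setD(3)[OF I] by (auto simp: F_def)
  have cN: "coef (F p) (N p) = 1" if "p \<in> P" for p
    using T fN[OF that] by (auto simp: cF in_keys_iff)
  have sF: "\<mu> \<in> supp (f p)" if "\<mu> \<in> supp (F p)" for p \<mu>
    using that by (auto simp: cF in_keys_iff)
  \<comment> \<open>Row \<open>p\<close> splits \<open>F p\<close> by the position to which each
    term leads; \<open>N p\<close> itself stays at \<open>p\<close>.\<close>
  define A where "A p q = filt (\<lambda>\<mu>. p + (udeg u \<mu> - udeg u (N p)) = q) (F p)" for p q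
  have "\<exists>M g. g \<in> I \<and> g - trm M 1 \<in> above u \<omega> (udeg u M) (wdot \<omega> M)"
  proof (rule elimination)
    show "finite P" "P \<noteq> {}" using \<rho>0 K1 by (auto simp: P_def)
    show "is_ideal_set I" by fact
    fix p assume p: "p \<in> P"
    have "(\<Sum>q\<in>P. A p q) = F p"
      unfolding A_def
    proof (rule sum_filt_fibres)
      fix \<mu> assume "\<mu> \<in> supp (F p)"
      then show "p + (udeg u \<mu> - udeg u (N p)) \<in> P"
        using step[OF p sF] p by (cases "\<mu> = N p") auto
    qed (fact \<open>finite P\<close>)
    then show "(\<Sum>q\<in>P. A p q) \<in> I" using FI[OF p] by simp
    show "A p p - trm (N p) 1 \<in> above u \<omega> (udeg u (N p)) (wdot \<omega> (N p))"
      unfolding above_def mem_Collect_eq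
    proof
      fix \<mu> assume \<mu>: "\<mu> \<in> supp (A p p - trm (N p) 1)"
      then have ne: "\<mu> \<noteq> N p"
        using cN[OF p] by (auto simp: in_keys_iff lookup_minus A_def lookup_filt)
      with \<mu> have "\<mu> \<in> supp (F p)" "udeg u \<mu> = udeg u (N p)"
        by (auto simp: in_keys_iff lookup_minus A_def lookup_filt lookup_single_not_eq split: if_splits)
      with step[OF p sF ne] show "udeg u \<mu> = udeg u (N p) \<and> wdot \<omega> (N p) < wdot \<omega> \<mu>" by auto
    qed
    fix q assume q: "p \<noteq> q"
    show "A p q \<in> above u \<omega> (udeg u (N p) + (q - p)) (wdot \<omega> (N p) + (\<phi> q - \<phi> p))"
      unfolding above_def mem_Collect_eq
    proof
      fix \<mu> assume \<mu>: "\<mu> \<in> supp (A p q)"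
      then have 1: "\<mu> \<in> supp (F p)" "p + (udeg u \<mu> - udeg u (N p)) = q"
        by (auto simp: A_def supp_filt)
      with q have "\<mu> \<noteq> N p" by auto
      with step[OF p sF[OF 1(1)]] 1(2)
      show "udeg u \<mu> = udeg u (N p) + (q - p) \<and> wdot \<omega> (N p) + (\<phi> q - \<phi> p) < wdot \<omega> \<mu>" by auto
    qed
  qed
  then obtain M g where g: "g \<in> I" "g - trm M 1 \<in> above u \<omega> (udeg u M) (wdot \<omega> M)" by blast
  note l = lead_above[OF g(2)]
  \<comment> \<open>\<open>g\<close> has a single \<open>u\<close>-weight, so each of its components
    is \<open>g\<close> or zero.\<close>
  have "filt (\<lambda>\<nu>. udeg u \<nu> = w) g \<in> I" for w
  proof (cases "w = udeg u M")
    case True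
    then have "filt (\<lambda>\<nu>. udeg u \<nu> = w) g = g" using l(2) by (intro filt_self) auto
    then show ?thesis using g(1) by simp
  next
    case False
    then have "filt (\<lambda>\<nu>. udeg u \<nu> = w) g = 0" using l(2) by (intro filt_none) auto
    then show ?thesis using is_ideal_setD(1)[OF I] by simp
  qed
  then show ?thesis using l(1) by (auto simp: core1_def)
qed

subsection \<open>Monomial orders and Groebner bases\<close>

text \<open>A monotone subsequence that is not increasing is decreasing, hence constant once it
  attains its minimum.\<close>

lemma nat_seq_mono_subseq:
  fixes s :: "nat \<Rightarrow> nat"
  shows "\<exists>r::nat \<Rightarrow> nat. strict_mono r \<and> mono (s \<circ> r)"
proof -
  obtain r where r: "strict_mono (r :: nat \<Rightarrow> nat)" "monoseq (\<lambda>n. s (r n))"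
    using seq_monosub[of s] by blast
  show ?thesis
  proof (cases "incseq (\<lambda>n. s (r n))")
    case True
    then show ?thesis using r(1) by (intro exI[of _ r]) (auto simp: comp_def)
  next
    case False
    then have dec: "decseq (\<lambda>n. s (r n))" using r(2) by (auto simp: monoseq_iff)
    define m where "m = (LEAST x. x \<in> range (\<lambda>n. s (r n)))"
    have "m \<in> range (\<lambda>n. s (r n))" unfolding m_def by (rule LeastI_ex) blast
    then obtain n where n: "m = s (r n)" by blast
    have "s (r (n + i)) = m" for i
    proof (rule antisym)
      show "s (r (n + i)) \<le> m" using decseqD[OF dec, of n "n + i"] n by simp
      show "m \<le> s (r (n + i))" unfolding m_def by (rule Least_le) blast
    qed
    moreover have "strict_mono (\<lambda>i. r (n + i))"
      using r(1) by (simp add: strict_mono_def)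
    ultimately show ?thesis
      by (intro exI[of _ "\<lambda>i. r (n + i)"]) (auto simp: mono_def)
  qed
qed

lemma mono_subseq_coords:
  fixes s :: "nat \<Rightarrow> ('n \<Rightarrow>\<^sub>0 nat)"
  assumes "finite K"
  shows "\<exists>r::nat \<Rightarrow> nat. strict_mono r \<and> (\<forall>k\<in>K. mono (\<lambda>i. coef (s (r i)) k))"
  using assms
proof (induction K)
  case empty
  show ?case by (intro exI[of _ id]) (auto simp: strict_mono_def)
next
  case (insert k K)
  then obtain r :: "nat \<Rightarrow> nat" where r: "strict_mono r" "\<forall>k\<in>K. mono (\<lambda>i. coef (s (r i)) k)" by blast
  obtain r' :: "nat \<Rightarrow> nat" where r': "strict_mono r'" "mono ((\<lambda>i. coef (s (r i)) k) \<circ> r')"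
    using nat_seq_mono_subseq[of "\<lambda>i. coef (s (r i)) k"] by blast
  have "mono r'" using r'(1) by (rule strict_mono_mono)
  show ?case
  proof (intro exI[of _ "r \<circ> r'"] conjI ballI)
    show "strict_mono (r \<circ> r')" using r(1) r'(1) by (rule strict_mono_o)
    fix j assume "j \<in> insert k K"
    then show "mono (\<lambda>i. coef (s ((r \<circ> r') i)) j)"
    proof
      assume "j = k" then show ?thesis using r'(2) by (simp add: comp_def)
    next
      assume "j \<in> K"
      then have "mono (\<lambda>i. coef (s (r i)) j)" using r(2) by blast
      then show ?thesis using \<open>mono r'\<close> by (auto simp: mono_def)
    qed
  qed
qed

text \<open>\<open>F\<close> consists of the elements minimal for divisibility. Infinitely many
  would contain two comparable ones along a coordinatewise monotone sequence; descent in total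
  degree leads from any \<open>t\<close> to \<open>F\<close>.\<close>

lemma Dickson:
  fixes T :: "('n::finite \<Rightarrow>\<^sub>0 nat) set"
  shows "\<exists>F. finite F \<and> F \<subseteq> T \<and> (\<forall>t\<in>T. \<exists>s\<in>F. \<exists>\<alpha>. t = \<alpha> + s)"
proof -
  define F where "F = {t\<in>T. \<forall>s\<in>T. \<forall>\<alpha>. t = \<alpha> + s \<longrightarrow> s = t}"
  have "finite F"
  proof (rule ccontr)
    assume "infinite F"
    then obtain s :: "nat \<Rightarrow> _" where s: "inj s" "range s \<subseteq> F"
      using infinite_countable_subset by blast
    obtain r :: "nat \<Rightarrow> nat" where r: "strict_mono r" "\<forall>k\<in>UNIV. mono (\<lambda>i. coef (s (r i)) k)"
      using mono_subseq_coords[of UNIV s] by auto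
    have le: "coef (s (r 0)) k \<le> coef (s (r 1)) k" for k
      using r(2) by (auto simp: mono_def)
    have "s (r 1) = (s (r 1) - s (r 0)) + s (r 0)"
      using le by (intro poly_mapping_eqI) (simp add: lookup_add lookup_minus)
    moreover have "s (r 1) \<in> F" "s (r 0) \<in> F" using s(2) by auto
    ultimately have "s (r 0) = s (r 1)" unfolding F_def by blast
    then have "r 0 = r 1" using s(1) by (simp add: inj_eq)
    then show False using r(1) by (metis strict_mono_eq zero_neq_one)
  qed
  moreover have "\<exists>s\<in>F. \<exists>\<alpha>. t = \<alpha> + s" if "t \<in> T" for t
    using that
  proof (induction "mdeg t" arbitrary: t rule: less_induct)
    case less
    show ?case
    proof (cases "t \<in> F")
      case True
      then show ?thesis by (metis add_0)
    next
      case False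
      then obtain s \<alpha> where s: "s \<in> T" "t = \<alpha> + s" "s \<noteq> t"
        using less.prems unfolding F_def by blast
      have "mdeg \<alpha> \<noteq> 0"
      proof
        assume "mdeg \<alpha> = 0"
        then have "\<alpha> = 0" by (intro poly_mapping_eqI) (simp add: mdeg_UNIV)
        then show False using s by simp
      qed
      then have "mdeg s < mdeg t" using s(2) by (simp add: mdeg_add)
      then obtain s' \<beta> where "s' \<in> F" "s = \<beta> + s'" using less.hyps s(1) by blast
      then show ?thesis using s(2) by (metis add.assoc)
    qed
  qed
  ultimately show ?thesis by (intro exI[of _ F]) (auto simp: F_def)
qed

text \<open>Confines reduction in one degree to finitely many exponents. This replaces
  well-foundedness, which weights with negative entries do not give.\<close>

lemma finite_mdeg: "finite {\<nu> :: 'n::finite \<Rightarrow>\<^sub>0 nat. mdeg \<nu> = d}"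
proof (rule finite_subset)
  show "finite (Abs_poly_mapping ` (PiE UNIV (\<lambda>_. {..d})) :: ('n \<Rightarrow>\<^sub>0 nat) set)"
    by (intro finite_imageI finite_PiE) auto
  show "{\<nu> :: 'n \<Rightarrow>\<^sub>0 nat. mdeg \<nu> = d} \<subseteq> Abs_poly_mapping ` (PiE UNIV (\<lambda>_. {..d}))"
  proof
    fix \<nu> :: "'n \<Rightarrow>\<^sub>0 nat" assume "\<nu> \<in> {\<nu>. mdeg \<nu> = d}"
    then have "coef \<nu> k \<le> d" for k
      by (auto simp: mdeg_UNIV intro: member_le_sum)
    then have "coef \<nu> \<in> PiE UNIV (\<lambda>_. {..d})" by auto
    then show "\<nu> \<in> Abs_poly_mapping ` (PiE UNIV (\<lambda>_. {..d}))"
      by (metis image_eqI poly_mapping.lookup_inverse)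
  qed
qed

text \<open>Two weight vectors followed by the exponents themselves, compared lexicographically,
  give a monomial order.\<close>
definition lexkey :: "real^'n \<Rightarrow> real^'n \<Rightarrow> ('n::finite \<Rightarrow>\<^sub>0 nat) \<Rightarrow> (nat \<Rightarrow>\<^sub>0 real)" where
  "lexkey a b \<nu> = trm 0 (wdot a \<nu>) + trm 1 (wdot b \<nu>) +
     (\<Sum>k\<in>UNIV. trm (2 + (SOME e :: 'n \<Rightarrow> nat. inj e) k) (real (coef \<nu> k)))"

lemma inj_some: "inj (SOME e :: 'n::finite \<Rightarrow> nat. inj e)"
proof -
  have "\<exists>e :: 'n \<Rightarrow> nat. inj e" using finite_imp_inj_to_nat_seg[of "UNIV :: 'n set"] by auto
  then show ?thesis by (rule someI_ex)
qed

lemma lookup_lexkey: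
  "coef (lexkey a b \<nu>) 0 = wdot a \<nu>" "coef (lexkey a b \<nu>) 1 = wdot b \<nu>"
  "coef (lexkey a b \<nu>) (2 + (SOME e :: 'n::finite \<Rightarrow> nat. inj e) k) = real (coef \<nu> k)"
  "coef (lexkey a b \<nu>) (Suc (Suc i)) = coef (lexkey a' b' \<nu>) (Suc (Suc i))"
proof -
  show "coef (lexkey a b \<nu>) 0 = wdot a \<nu>" "coef (lexkey a b \<nu>) 1 = wdot b \<nu>"
    by (simp_all add: lexkey_def lookup_add lookup_sum lookup_single)
  show "coef (lexkey a b \<nu>) (Suc (Suc i)) = coef (lexkey a' b' \<nu>) (Suc (Suc i))"
    by (simp add: lexkey_def lookup_add lookup_sum lookup_single)
  show "coef (lexkey a b \<nu>) (2 + (SOME e :: 'n::finite \<Rightarrow> nat. inj e) k) = real (coef \<nu> k)"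
    using inj_some[where 'n = 'n]
    by (simp add: lexkey_def lookup_add lookup_sum lookup_single inj_eq when_def)
qed

lemma inj_lexkey: "inj (lexkey a b :: ('n::finite \<Rightarrow>\<^sub>0 nat) \<Rightarrow> _)"
proof (rule injI, rule poly_mapping_eqI)
  fix \<mu> \<nu> :: "'n \<Rightarrow>\<^sub>0 nat" and k assume "lexkey a b \<mu> = lexkey a b \<nu>"
  then show "coef \<mu> k = coef \<nu> k"
    using lookup_lexkey(3)[of a b \<mu> k] lookup_lexkey(3)[of a b \<nu> k] by simp
qed

lemma lexkey_add: "lexkey a b (\<mu> + \<nu>) = lexkey a b \<mu> + lexkey a b \<nu>"
  by (simp add: lexkey_def wdot_add lookup_add single_add sum.distrib)

lemma all_less_Suc_split: "(\<forall>i<Suc n. P i) \<longleftrightarrow> P 0 \<and> (\<forall>i<n. P (Suc i))"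
  by (auto simp: less_Suc_eq_0_disj)

lemma ex_nat_split: "(\<exists>n::nat. P n) \<longleftrightarrow> P 0 \<or> (\<exists>n. P (Suc n))"
  by (metis not0_implies_Suc)

text \<open>The order on finitely supported functions decides at the first differing index. Entries
  from index 2 on ignore the weights, so \<open>lexkey 0 0\<close> is a common tie-breaker.\<close>

lemma less_lexkey_iff:
  "lexkey a b \<mu> < lexkey a b \<nu> \<longleftrightarrow> wdot a \<mu> < wdot a \<nu> \<or> wdot a \<mu> = wdot a \<nu> \<and>
     (wdot b \<mu> < wdot b \<nu> \<or> wdot b \<mu> = wdot b \<nu> \<and> lexkey 0 0 \<mu> < lexkey 0 0 \<nu>)"
proof -
  have split: "(\<exists>k::nat. P k \<and> (\<forall>k'<k. Q k')) \<longleftrightarrow>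
      P 0 \<or> Q 0 \<and> (P 1 \<or> Q 1 \<and> (\<exists>k. P (Suc (Suc k)) \<and> (\<forall>k'<k. Q (Suc (Suc k')))))" for P Q
    by (subst ex_nat_split, subst ex_nat_split) (auto simp: all_less_Suc_split)
  have z: "wdot 0 \<mu> = 0" for \<mu> by (simp add: wdot_UNIV)
  have "lexkey a b \<mu> < lexkey a b \<nu> \<longleftrightarrow> wdot a \<mu> < wdot a \<nu> \<or> wdot a \<mu> = wdot a \<nu> \<and>
     (wdot b \<mu> < wdot b \<nu> \<or> wdot b \<mu> = wdot b \<nu> \<and>
      (\<exists>k. coef (lexkey 0 0 \<mu>) (Suc (Suc k)) < coef (lexkey 0 0 \<nu>) (Suc (Suc k)) \<and>
        (\<forall>k'<k. coef (lexkey 0 0 \<mu>) (Suc (Suc k')) = coef (lexkey 0 0 \<nu>) (Suc (Suc k')))))" for a b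
    unfolding less_poly_mapping.rep_eq less_fun_def
    by (subst split) (simp only: lookup_lexkey(1,2) lookup_lexkey(4)[of a b _ _ 0 0])
  from this[of a b] this[of 0 0] show ?thesis by (simp add: z)
qed

text \<open>Division with remainder: the least reducible exponent is cancelled at the cost of larger
  ones. Finiteness of \<open>E\<close> gives termination, and the upward closed property
  \<open>Q\<close> passes to the remainder.\<close>

lemma reduction:
  fixes t :: "('n, 'a::field) mpoly" and \<kappa> :: "('n \<Rightarrow>\<^sub>0 nat) \<Rightarrow> 'o::linorder"
  assumes E: "finite E" and \<kappa>: "inj \<kappa>" and I: "is_ideal_set I"
    and S: "\<And>\<mu>. \<mu> \<in> S \<Longrightarrow> \<exists>h\<in>I. supp h \<subseteq> E \<and> lead \<kappa> \<mu> h"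
    and up: "\<And>\<mu> \<mu>'. Q \<mu> \<Longrightarrow> \<kappa> \<mu> < \<kappa> \<mu>' \<Longrightarrow> Q \<mu>'"
    and "supp t \<subseteq> E" "\<forall>\<mu>\<in>supp t. Q \<mu>"
  shows "\<exists>t'. supp t' \<subseteq> E \<and> supp t' \<inter> S = {} \<and> t - t' \<in> I \<and> (\<forall>\<mu>\<in>supp t'. Q \<mu>)"
  using assms(6,7)
proof (induction "card {e\<in>E \<inter> S. \<exists>\<mu>\<in>supp t \<inter> S. \<kappa> \<mu> \<le> \<kappa> e}" arbitrary: t rule: less_induct)
  case less
  show ?case
  proof (cases "supp t \<inter> S = {}")
    case True
    then show ?thesis using less.prems is_ideal_setD(1)[OF I] by (intro exI[of _ t]) auto
  next
    case False
    define \<mu> where "\<mu> = arg_min_on \<kappa> (supp t \<inter> S)"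
    have \<mu>: "\<mu> \<in> supp t" "\<mu> \<in> S" and min: "\<And>e. e \<in> supp t \<Longrightarrow> e \<in> S \<Longrightarrow> \<kappa> \<mu> \<le> \<kappa> e"
      using arg_min_if_finite(1)[of "supp t \<inter> S" \<kappa>] False arg_min_least[of "supp t \<inter> S" _ \<kappa>]
      by (auto simp: \<mu>_def)
    obtain h where h: "h \<in> I" "supp h \<subseteq> E" "lead \<kappa> \<mu> h" using S[OF \<mu>(2)] by blast
    define c where "c = coef t \<mu> / coef h \<mu>"
    define t1 where "t1 = t - trm 0 c * h"
    have co: "coef t1 \<nu> = coef t \<nu> - c * coef h \<nu>" for \<nu>
      using lookup_trm_mult[of 0 c h \<nu>] by (simp add: t1_def lookup_minus)
    have "coef h \<mu> \<noteq> 0" using h(3) by (simp add: lead_def in_keys_iff)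
    then have "coef t1 \<mu> = 0" by (simp add: co c_def)
    then have \<mu>1: "\<mu> \<notin> supp t1" by (simp add: in_keys_iff)
    have keys1: "\<nu> \<in> supp t \<or> \<nu> \<in> supp h" if "\<nu> \<in> supp t1" for \<nu>
      using that by (auto simp: in_keys_iff co)
    have gt: "\<kappa> \<mu> < \<kappa> \<nu>" if "\<nu> \<in> supp t1" "\<nu> \<in> S" for \<nu>
    proof -
      have "\<nu> \<noteq> \<mu>" using \<mu>1 that by auto
      then show ?thesis
        using keys1[OF that(1)] min[of \<nu>] that(2) h(3) injD[OF \<kappa>, of \<mu> \<nu>]
        by (auto simp: lead_def order.strict_iff_order)
    qed
    have Q1: "\<forall>\<nu>\<in>supp t1. Q \<nu>"
    proof
      fix \<nu> assume "\<nu> \<in> supp t1"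
      with keys1[OF this] h(3) \<mu>1 show "Q \<nu>"
        using less.prems(2) \<mu>(1) up[of \<mu> \<nu>] by (auto simp: lead_def)
    qed
    have s1: "supp t1 \<subseteq> E" using keys1 less.prems(1) h(2) by blast
    \<comment> \<open>The measure counts exponents of \<open>E \<inter> S\<close> at or above a
      reducible one of the current polynomial; \<open>\<mu>\<close> drops out.\<close>
    have "{e\<in>E \<inter> S. \<exists>\<mu>\<in>supp t1 \<inter> S. \<kappa> \<mu> \<le> \<kappa> e} \<subset> {e\<in>E \<inter> S. \<exists>\<mu>\<in>supp t \<inter> S. \<kappa> \<mu> \<le> \<kappa> e}"
    proof
      show "{e\<in>E \<inter> S. \<exists>\<mu>\<in>supp t1 \<inter> S. \<kappa> \<mu> \<le> \<kappa> e} \<subseteq> {e\<in>E \<inter> S. \<exists>\<mu>\<in>supp t \<inter> S. \<kappa> \<mu> \<le> \<kappa> e}"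
      proof
        fix e assume "e \<in> {e\<in>E \<inter> S. \<exists>\<mu>\<in>supp t1 \<inter> S. \<kappa> \<mu> \<le> \<kappa> e}"
        then obtain \<nu> where e: "e \<in> E" "e \<in> S" "\<nu> \<in> supp t1" "\<nu> \<in> S" "\<kappa> \<nu> \<le> \<kappa> e" by auto
        then have "\<kappa> \<mu> \<le> \<kappa> e" using gt[of \<nu>] by auto
        with \<mu> e show "e \<in> {e\<in>E \<inter> S. \<exists>\<mu>\<in>supp t \<inter> S. \<kappa> \<mu> \<le> \<kappa> e}" by auto
      qed
      have "\<mu> \<in> {e\<in>E \<inter> S. \<exists>\<mu>\<in>supp t \<inter> S. \<kappa> \<mu> \<le> \<kappa> e}" using \<mu> less.prems(1) by auto
      moreover have "\<mu> \<notin> {e\<in>E \<inter> S. \<exists>\<mu>\<in>supp t1 \<inter> S. \<kappa> \<mu> \<le> \<kappa> e}" using gt by force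
      ultimately show "{e\<in>E \<inter> S. \<exists>\<mu>\<in>supp t1 \<inter> S. \<kappa> \<mu> \<le> \<kappa> e} \<noteq> {e\<in>E \<inter> S. \<exists>\<mu>\<in>supp t \<inter> S. \<kappa> \<mu> \<le> \<kappa> e}"
        by blast
    qed
    then have "card {e\<in>E \<inter> S. \<exists>\<mu>\<in>supp t1 \<inter> S. \<kappa> \<mu> \<le> \<kappa> e} < card {e\<in>E \<inter> S. \<exists>\<mu>\<in>supp t \<inter> S. \<kappa> \<mu> \<le> \<kappa> e}"
      using E by (intro psubset_card_mono) auto
    from less.hyps[OF this s1 Q1] obtain t' where
      t': "supp t' \<subseteq> E" "supp t' \<inter> S = {}" "t1 - t' \<in> I" "\<forall>\<mu>\<in>supp t'. Q \<mu>" by blast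
    have "t - t' = (t1 - t') + trm 0 c * h" by (simp add: t1_def)
    then have "t - t' \<in> I" using t'(3) h(1) is_ideal_setD(2,3)[OF I] by metis
    then show ?thesis using t' by blast
  qed
qed

subsection \<open>Projection of the tropical variety along \<open>u\<close>\<close>

text \<open>A Groebner basis for the order \<open>(u, \<omega>)\<close> is also one for the weight \<open>\<omega> + v u\<close> with \<open>v\<close>
  large; comparing normal forms transfers a leading monomial from the latter to the former.\<close>
lemma lead_at_infinity:
  fixes I :: "('n::finite, 'a::field) mpoly set"
  assumes gr: "graded_ideal I"
    and ex: "\<And>v. \<exists>f\<in>I. \<exists>\<nu>. lead (wdot (\<omega> + v *\<^sub>R u)) \<nu> f"
  shows "\<exists>f\<in>I. \<exists>\<nu>\<in>supp f. \<forall>\<mu>\<in>supp f. \<mu> \<noteq> \<nu> \<longrightarrow>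
    wdot u \<nu> < wdot u \<mu> \<or> wdot u \<nu> = wdot u \<mu> \<and> wdot \<omega> \<nu> < wdot \<omega> \<mu>"
proof -
  have I: "is_ideal_set I" and hI: "\<And>f d. f \<in> I \<Longrightarrow> homog_part d f \<in> I"
    using gr by (auto simp: graded_ideal_def)
  define \<kappa> :: "('n \<Rightarrow>\<^sub>0 nat) \<Rightarrow> nat \<Rightarrow>\<^sub>0 real" where "\<kappa> = lexkey u \<omega>"
  define H where "H = {f\<in>I. f \<noteq> 0 \<and> (\<exists>d. \<forall>\<mu>\<in>supp f. mdeg \<mu> = d)}"
  define T where "T = {\<nu>. \<exists>f\<in>H. lead \<kappa> \<nu> f}"
  obtain F where F: "finite F" "F \<subseteq> T" "\<And>t. t \<in> T \<Longrightarrow> \<exists>s\<in>F. \<exists>\<alpha>. t = \<alpha> + s"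
    using Dickson[of T] by blast
  have "\<forall>m\<in>F. \<exists>f. f \<in> H \<and> lead \<kappa> m f" using F(2) by (auto simp: T_def)
  then obtain g where g: "\<And>m. m \<in> F \<Longrightarrow> g m \<in> H" "\<And>m. m \<in> F \<Longrightarrow> lead \<kappa> m (g m)" by metis
  have wd: "wdot (\<omega> + v *\<^sub>R u) \<mu> = wdot \<omega> \<mu> + v * wdot u \<mu>" for v \<mu>
    by (simp add: wdot_add_left wdot_scaleR)
  \<comment> \<open>If the \<open>u\<close>-weights differ, large \<open>v\<close> decides the
    comparison; if they agree, \<open>\<omega>\<close> decides or ties.\<close>
  have "\<forall>\<^sub>F v in at_top. \<forall>m\<in>F. \<forall>\<mu>\<in>supp (g m) - {m}.
      wdot (\<omega> + v *\<^sub>R u) m < wdot (\<omega> + v *\<^sub>R u) \<mu> \<or>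
      wdot u m = wdot u \<mu> \<and> wdot (\<omega> + v *\<^sub>R u) m = wdot (\<omega> + v *\<^sub>R u) \<mu>"
  proof (intro eventually_ball_finite ballI F(1) finite_Diff finite_keys)
    fix m \<mu> assume m: "m \<in> F" and \<mu>: "\<mu> \<in> supp (g m) - {m}"
    have k: "\<kappa> m < \<kappa> \<mu>" using g(2)[OF m] \<mu> by (auto simp: lead_def)
    show "\<forall>\<^sub>F v in at_top. wdot (\<omega> + v *\<^sub>R u) m < wdot (\<omega> + v *\<^sub>R u) \<mu> \<or>
      wdot u m = wdot u \<mu> \<and> wdot (\<omega> + v *\<^sub>R u) m = wdot (\<omega> + v *\<^sub>R u) \<mu>"
    proof (cases "wdot u m = wdot u \<mu>")
      case True
      then show ?thesis using k by (auto simp: \<kappa>_def less_lexkey_iff[of u \<omega>] wd)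
    next
      case False
      then have d: "wdot u \<mu> - wdot u m > 0" using k by (auto simp: \<kappa>_def less_lexkey_iff[of u \<omega>])
      show ?thesis
        using eventually_gt_at_top[of "(wdot \<omega> m - wdot \<omega> \<mu>) / (wdot u \<mu> - wdot u m)"]
        by eventually_elim (use d in \<open>simp add: wd field_simps\<close>)
    qed
  qed
  then obtain v where v: "\<And>m \<mu>. m \<in> F \<Longrightarrow> \<mu> \<in> supp (g m) \<Longrightarrow> \<mu> \<noteq> m \<Longrightarrow>
      wdot (\<omega> + v *\<^sub>R u) m < wdot (\<omega> + v *\<^sub>R u) \<mu> \<or>
      wdot u m = wdot u \<mu> \<and> wdot (\<omega> + v *\<^sub>R u) m = wdot (\<omega> + v *\<^sub>R u) \<mu>"
    using eventually_happens'[OF trivial_limit_at_top_linorder] by fastforce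
  define a where "a = \<omega> + v *\<^sub>R u"
  \<comment> \<open>Ties in \<open>a\<close> are broken by \<open>u\<close>; if both agree, so do
    the \<open>\<omega>\<close>-weights, and the tie-breaker of \<open>\<kappa>\<close> remains.
    Hence the basis keeps its leading exponents.\<close>
  define \<kappa>' where "\<kappa>' = lexkey a u"
  have lead': "lead \<kappa>' m (g m)" if m: "m \<in> F" for m
    unfolding lead_def
  proof (intro conjI ballI impI)
    show "m \<in> supp (g m)" using g(2)[OF m] by (simp add: lead_def)
    fix \<mu> assume \<mu>: "\<mu> \<in> supp (g m)" "\<mu> \<noteq> m"
    have k: "\<kappa> m < \<kappa> \<mu>" using g(2)[OF m] \<mu> by (auto simp: lead_def)
    from v[OF m \<mu>] show "\<kappa>' m < \<kappa>' \<mu>"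
    proof
      assume *: "wdot u m = wdot u \<mu> \<and> wdot (\<omega> + v *\<^sub>R u) m = wdot (\<omega> + v *\<^sub>R u) \<mu>"
      then have "wdot \<omega> m = wdot \<omega> \<mu>" by (auto simp: wd)
      then show ?thesis using * k by (auto simp: \<kappa>_def \<kappa>'_def a_def less_lexkey_iff[of u] less_lexkey_iff[of "\<omega> + v *\<^sub>R u"])
    qed (auto simp: \<kappa>'_def a_def less_lexkey_iff[of "\<omega> + v *\<^sub>R u"])
  qed
  obtain f \<nu> where f: "f \<in> I" "lead (wdot a) \<nu> f" using ex[of v] by (auto simp: a_def)
  define d where "d = mdeg \<nu>"
  define E where "E = {\<mu> :: 'n \<Rightarrow>\<^sub>0 nat. mdeg \<mu> = d}"
  have finE: "finite E" unfolding E_def by (rule finite_mdeg)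
  \<comment> \<open>Gradedness keeps the part of \<open>f\<close> containing \<open>\<nu>\<close> in
    \<open>I\<close>.\<close>
  define f1 where "f1 = homog_part d f"
  have f1: "f1 \<in> I" "lead (wdot a) \<nu> f1" "supp f1 \<subseteq> E"
    using f hI by (auto simp: f1_def homog_part_filt d_def E_def supp_filt intro: lead_filt)
  define S where "S = T \<inter> E"
  have S: "\<exists>h\<in>I. supp h \<subseteq> E \<and> lead \<kappa>' \<mu> h" if \<mu>: "\<mu> \<in> S" for \<mu>
  proof -
    obtain m \<alpha> where m: "m \<in> F" "\<mu> = \<alpha> + m" using F(3)[of \<mu>] \<mu> by (auto simp: S_def)
    obtain e where e: "\<And>\<beta>. \<beta> \<in> supp (g m) \<Longrightarrow> mdeg \<beta> = e" using g(1)[OF m(1)] by (auto simp: H_def)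
    have "m \<in> supp (g m)" using g(2)[OF m(1)] by (simp add: lead_def)
    then have "mdeg \<alpha> + e = d" using \<mu> m(2) e[of m] by (simp add: S_def E_def mdeg_add)
    then have "supp (trm \<alpha> 1 * g m) \<subseteq> E"
      using supp_trm_mult[of \<alpha> 1 "g m"] e by (fastforce simp: E_def mdeg_add)
    moreover have "lead \<kappa>' \<mu> (trm \<alpha> 1 * g m)"
      unfolding m(2) using lead'[OF m(1)] by (intro lead_trm_mult) (simp_all add: \<kappa>'_def lexkey_add)
    moreover have "trm \<alpha> 1 * g m \<in> I" using g(1)[OF m(1)] is_ideal_setD(3)[OF I] by (simp add: H_def)
    ultimately show ?thesis by blast
  qed
  define t where "t = f1 - trm \<nu> (coef f1 \<nu>)"
  have t: "\<mu> \<in> supp t \<longleftrightarrow> \<mu> \<in> supp f1 \<and> \<mu> \<noteq> \<nu>" for \<mu>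
    by (auto simp: t_def in_keys_iff lookup_minus lookup_single when_def)
  \<comment> \<open>Only the tail is reduced, so \<open>\<nu>\<close> stays leading for
    \<open>a\<close>.\<close>
  have "\<exists>t'. supp t' \<subseteq> E \<and> supp t' \<inter> S = {} \<and> t - t' \<in> I \<and> (\<forall>\<mu>\<in>supp t'. wdot a \<nu> < wdot a \<mu>)"
  proof (rule reduction[where \<kappa> = \<kappa>'])
    show "inj \<kappa>'" unfolding \<kappa>'_def by (rule inj_lexkey)
    show "supp t \<subseteq> E" using t f1(3) by auto
    show "\<forall>\<mu>\<in>supp t. wdot a \<nu> < wdot a \<mu>" using t f1(2) by (auto simp: lead_def)
    show "wdot a \<nu> < wdot a \<mu>'" if "wdot a \<nu> < wdot a \<mu>" "\<kappa>' \<mu> < \<kappa>' \<mu>'" for \<mu> \<mu>'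
      using that by (auto simp: \<kappa>'_def less_lexkey_iff[of a])
  qed (use S I finE in auto)
  then obtain t' where t': "supp t' \<subseteq> E" "supp t' \<inter> S = {}" "t - t' \<in> I" "\<And>\<mu>. \<mu> \<in> supp t' \<Longrightarrow> wdot a \<nu> < wdot a \<mu>"
    by blast
  define f' where "f' = t' + trm \<nu> (coef f1 \<nu>)"
  have c: "coef f1 \<nu> \<noteq> 0" using f1(2) by (simp add: lead_def in_keys_iff)
  have \<nu>t': "\<nu> \<notin> supp t'" using t'(4) by blast
  have supp': "supp f' = insert \<nu> (supp t')"
    using c \<nu>t' by (auto simp: f'_def in_keys_iff lookup_add lookup_single when_def split: if_splits)
  have "f' = f1 - (t - t')" by (simp add: f'_def t_def)
  then have "f' \<in> I" using f1(1) t'(3) is_ideal_setD(4)[OF I] by metis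
  moreover have "\<nu> \<in> E" by (simp add: E_def d_def)
  moreover have "f' \<noteq> 0" using supp' by auto
  ultimately have "f' \<in> H" using t'(1) supp' by (auto simp: H_def E_def)
  \<comment> \<open>As \<open>f'\<close> is in \<open>H\<close>, its \<open>\<kappa>\<close>-leading
    exponent lies in \<open>T\<close>; the reduced tail avoids \<open>T\<close>, which leaves only
    \<open>\<nu>\<close>.\<close>
  obtain \<nu>' where \<nu>': "lead \<kappa> \<nu>' f'"
    using lead_exists[OF inj_lexkey \<open>f' \<noteq> 0\<close>] unfolding \<kappa>_def by blast
  then have "\<nu>' \<in> T" using \<open>f' \<in> H\<close> by (auto simp: T_def)
  moreover have "\<nu>' \<in> insert \<nu> (supp t')" using \<nu>' supp' by (auto simp: lead_def)
  ultimately have "\<nu>' = \<nu>" using t'(1,2) by (auto simp: S_def)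
  then have k: "\<kappa> \<nu> < \<kappa> \<mu>" if "\<mu> \<in> supp f'" "\<mu> \<noteq> \<nu>" for \<mu>
    using \<nu>' that by (auto simp: lead_def)
  show ?thesis
  proof (intro bexI ballI impI)
    show "f' \<in> I" by fact
    show "\<nu> \<in> supp f'" using supp' by simp
    fix \<mu> assume \<mu>: "\<mu> \<in> supp f'" "\<mu> \<noteq> \<nu>"
    then have "wdot a \<nu> < wdot a \<mu>" using supp' t'(4) by auto
    then show "wdot u \<nu> < wdot u \<mu> \<or> wdot u \<nu> = wdot u \<mu> \<and> wdot \<omega> \<nu> < wdot \<omega> \<mu>"
      using k[OF \<mu>] by (auto simp: a_def wd \<kappa>_def less_lexkey_iff[of u])
  qed
qed


text \<open>Suppose that no point of the line \<open>\<omega> + v u\<close> lies in the tropical variety. Then finitely many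
  elements of the ideal witness this for all \<open>v\<close>, with a uniform margin: two of them deal with
  large \<open>\<bar>v\<bar>\<close>, and compactness deals with the rest.\<close>
lemma trop_core1_subset:
  fixes I :: "('n::finite, 'a::field) mpoly set"
  assumes gr: "graded_ideal I" and \<omega>: "\<omega> \<in> trop (core1 u I)"
  shows "\<exists>v. \<omega> + v *\<^sub>R int_vec u \<in> trop I"
proof (rule ccontr)
  assume "\<nexists>v. \<omega> + v *\<^sub>R int_vec u \<in> trop I"
  then have no: "\<exists>f\<in>I. \<exists>\<nu>. lead (wdot (\<omega> + v *\<^sub>R int_vec u)) \<nu> f" for v
    by (auto simp: trop_iff)
  \<comment> \<open>Reversing \<open>u\<close> will cover \<open>v\<close> tending to minus
    infinity.\<close>
  have no': "\<exists>f\<in>I. \<exists>\<nu>. lead (wdot (\<omega> + v *\<^sub>R (- int_vec u))) \<nu> f" for v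
    using no[of "- v"] by simp
  have I: "is_ideal_set I" using gr by (simp add: graded_ideal_def)
  have w: "wdot (int_vec u) \<mu> = udeg u \<mu>" "wdot (- int_vec u) \<mu> = - real_of_int (udeg u \<mu>)" for \<mu>
    using wdot_scaleR[of "-1" "int_vec u" \<mu>] by (simp_all add: wdot_int_vec)
  \<comment> \<open>Margin of \<open>\<mu>\<close> over \<open>\<nu>\<close> at parameter
    \<open>v\<close>, affine in \<open>v\<close>.\<close>
  define m where "m \<nu> \<mu> v = (wdot \<omega> \<mu> - wdot \<omega> \<nu>) + v * (udeg u \<mu> - udeg u \<nu>)" for \<nu> \<mu> and v :: real
  have m: "wdot (\<omega> + v *\<^sub>R int_vec u) \<nu> < wdot (\<omega> + v *\<^sub>R int_vec u) \<mu> \<longleftrightarrow> 0 < m \<nu> \<mu> v" for \<mu> \<nu> v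
    by (simp add: wdot_add_left wdot_scaleR w m_def algebra_simps)
  obtain f1 \<nu>1 where f1: "f1 \<in> I" "\<nu>1 \<in> supp f1" and
    f1': "\<And>\<mu>. \<mu> \<in> supp f1 \<Longrightarrow> \<mu> \<noteq> \<nu>1 \<Longrightarrow> udeg u \<nu>1 < udeg u \<mu> \<or> udeg u \<nu>1 = udeg u \<mu> \<and> wdot \<omega> \<nu>1 < wdot \<omega> \<mu>"
    using lead_at_infinity[OF gr no] by (auto simp: w)
  obtain f2 \<nu>2 where f2: "f2 \<in> I" "\<nu>2 \<in> supp f2" and
    f2': "\<And>\<mu>. \<mu> \<in> supp f2 \<Longrightarrow> \<mu> \<noteq> \<nu>2 \<Longrightarrow> udeg u \<mu> < udeg u \<nu>2 \<or> udeg u \<mu> = udeg u \<nu>2 \<and> wdot \<omega> \<nu>2 < wdot \<omega> \<mu>"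
    using lead_at_infinity[OF gr no'] by (auto simp: w) metis
  have lin: "\<forall>\<^sub>F v in at_top. 0 < c + v * d" if "0 < d \<or> d = 0 \<and> 0 < c" for c d :: real
  proof (cases "d = 0")
    case False
    then have d: "d > 0" using that by auto
    show ?thesis using eventually_gt_at_top[of "- c / d"]
      by eventually_elim (use d in \<open>simp add: field_simps\<close>)
  qed (use that in auto)
  have "\<forall>\<^sub>F v in at_top. 0 < v \<and> (\<forall>\<mu>\<in>supp f1 - {\<nu>1}. 0 < m \<nu>1 \<mu> v) \<and> (\<forall>\<mu>\<in>supp f2 - {\<nu>2}. 0 < m \<nu>2 \<mu> (- v))"
  proof (intro eventually_conj eventually_ball_finite ballI finite_Diff finite_keys eventually_gt_at_top)
    fix \<mu> assume "\<mu> \<in> supp f1 - {\<nu>1}"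
    then show "\<forall>\<^sub>F v in at_top. 0 < m \<nu>1 \<mu> v" unfolding m_def using f1'[of \<mu>] by (intro lin) auto
  next
    fix \<mu> assume "\<mu> \<in> supp f2 - {\<nu>2}"
    then show "\<forall>\<^sub>F v in at_top. 0 < m \<nu>2 \<mu> (- v)"
      unfolding m_def minus_mult_commute using f2'[of \<mu>] by (intro lin) auto
  qed
  then obtain V where V: "V > 0" "\<And>\<mu>. \<mu> \<in> supp f1 - {\<nu>1} \<Longrightarrow> 0 < m \<nu>1 \<mu> V" "\<And>\<mu>. \<mu> \<in> supp f2 - {\<nu>2} \<Longrightarrow> 0 < m \<nu>2 \<mu> (- V)"
    using eventually_happens'[OF trivial_limit_at_top_linorder] by blast
  \<comment> \<open>The index \<open>n\<close> records a margin \<open>1 / (n + 1)\<close>, so that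
    a finite subcover has a common positive margin.\<close>
  define X where "X = {(f, \<nu>, n :: nat). f \<in> I \<and> \<nu> \<in> supp f}"
  define U where "U = (\<lambda>(f :: ('n, 'a) mpoly, \<nu>, n). \<Inter>\<mu>\<in>supp f - {\<nu>}. {v. inverse (real (Suc n)) < m \<nu> \<mu> v})"
  have "{-V..V} \<subseteq> \<Union>(U ` X)"
  proof
    fix v
    obtain f \<nu> where f: "f \<in> I" "lead (wdot (\<omega> + v *\<^sub>R int_vec u)) \<nu> f" using no by blast
    have "\<forall>\<^sub>F n in sequentially. \<forall>\<mu>\<in>supp f - {\<nu>}. inverse (real (Suc n)) < m \<nu> \<mu> v"
    proof (intro eventually_ball_finite ballI)
      fix \<mu> assume "\<mu> \<in> supp f - {\<nu>}"
      then have "0 < m \<nu> \<mu> v" using f(2) by (auto simp: lead_def m)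
      then show "\<forall>\<^sub>F n in sequentially. inverse (real (Suc n)) < m \<nu> \<mu> v"
        by (rule order_tendstoD(2)[OF LIMSEQ_inverse_real_of_nat])
    qed auto
    then obtain n where "\<forall>\<mu>\<in>supp f - {\<nu>}. inverse (real (Suc n)) < m \<nu> \<mu> v"
      using eventually_happens'[OF sequentially_bot] by blast
    then have "v \<in> U (f, \<nu>, n)" by (simp add: U_def)
    moreover have "(f, \<nu>, n) \<in> X" using f by (simp add: X_def lead_def)
    ultimately show "v \<in> \<Union>(U ` X)" by blast
  qed
  moreover have "open (U x)" for x
    unfolding U_def m_def by (auto split: prod.split intro!: open_INT open_Collect_less continuous_intros)
  ultimately obtain Y where Y: "Y \<subseteq> X" "finite Y" "{-V..V} \<subseteq> \<Union>(U ` Y)"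
    using compactE_image[of "{-V..V}" X U] by (metis compact_Icc)
  have le: "\<forall>\<^sub>F \<delta> in at_right 0. \<delta> \<le> c" if "c > 0" for c :: real
    using that eventually_at_right_field by (metis less_imp_le)
  have "\<forall>\<^sub>F \<delta> in at_right (0::real). 0 < \<delta> \<and> (\<forall>(f, \<nu>, n)\<in>Y. \<delta> \<le> inverse (real (Suc n))) \<and>
      (\<forall>\<mu>\<in>supp f1 - {\<nu>1}. \<delta> \<le> m \<nu>1 \<mu> V) \<and> (\<forall>\<mu>\<in>supp f2 - {\<nu>2}. \<delta> \<le> m \<nu>2 \<mu> (- V))"
    using Y(2) V by (intro eventually_conj eventually_ball_finite ballI)
      (auto intro!: le eventually_at_right_less simp: split_beta)
  then obtain \<delta> where "0 < \<delta> \<and> (\<forall>(f, \<nu>, n)\<in>Y. \<delta> \<le> inverse (real (Suc n))) \<and>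
      (\<forall>\<mu>\<in>supp f1 - {\<nu>1}. \<delta> \<le> m \<nu>1 \<mu> V) \<and> (\<forall>\<mu>\<in>supp f2 - {\<nu>2}. \<delta> \<le> m \<nu>2 \<mu> (- V))"
    using eventually_happens'[OF trivial_limit_at_right_real] by blast
  then have \<delta>: "\<delta> > 0" "\<And>f \<nu> n. (f, \<nu>, n) \<in> Y \<Longrightarrow> \<delta> \<le> inverse (real (Suc n))"
      "\<And>\<mu>. \<mu> \<in> supp f1 - {\<nu>1} \<Longrightarrow> \<delta> \<le> m \<nu>1 \<mu> V" "\<And>\<mu>. \<mu> \<in> supp f2 - {\<nu>2} \<Longrightarrow> \<delta> \<le> m \<nu>2 \<mu> (- V)"
    by blast+
  define T where "T = insert (f1, \<nu>1) (insert (f2, \<nu>2) ((\<lambda>(f, \<nu>, n). (f, \<nu>)) ` Y))"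
  have "\<exists>g\<in>core1 u I. \<exists>M. lead (wdot \<omega>) M g"
  proof (rule steering[OF I _ \<delta>(1)])
    show "finite T" using Y(2) by (simp add: T_def)
    show "f \<in> I \<and> \<nu> \<in> supp f" if "(f, \<nu>) \<in> T" for f \<nu>
      using that f1 f2 Y(1) by (auto simp: T_def X_def)
    fix v :: real
    \<comment> \<open>The endpoints go to the outer cases, which must meet the sign conditions;
      strictly between them these conditions are vacuous.\<close>
    consider "v \<ge> V" | "v \<le> - V" | "v \<in> {-V..V}" "v \<noteq> V" "v \<noteq> - V" by fastforce
    then show "\<exists>(f, \<nu>)\<in>T. \<forall>\<mu>\<in>supp f. \<mu> \<noteq> \<nu> \<longrightarrow>
      \<delta> \<le> wdot \<omega> \<mu> - wdot \<omega> \<nu> + v * (udeg u \<mu> - udeg u \<nu>) \<and>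
      (v \<ge> V \<longrightarrow> udeg u \<nu> \<le> udeg u \<mu>) \<and> (v \<le> - V \<longrightarrow> udeg u \<mu> \<le> udeg u \<nu>)"
    proof cases
      case 1
      \<comment> \<open>The slope in \<open>v\<close> is nonnegative, so the margin at
        \<open>V\<close> persists to the right.\<close>
      have "\<delta> \<le> m \<nu>1 \<mu> v \<and> udeg u \<nu>1 \<le> udeg u \<mu>" if \<mu>: "\<mu> \<in> supp f1" "\<mu> \<noteq> \<nu>1" for \<mu>
      proof -
        have p: "udeg u \<nu>1 \<le> udeg u \<mu>" using f1'[OF \<mu>] by auto
        then have "V * (udeg u \<mu> - udeg u \<nu>1) \<le> v * (udeg u \<mu> - udeg u \<nu>1)"
          using 1 by (intro mult_right_mono) auto
        then show ?thesis using \<delta>(3)[of \<mu>] \<mu> p by (auto simp: m_def)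
      qed
      then show ?thesis using 1 V(1) by (intro bexI[of _ "(f1, \<nu>1)"]) (auto simp: T_def m_def)
    next
      case 2
      have "\<delta> \<le> m \<nu>2 \<mu> v \<and> udeg u \<mu> \<le> udeg u \<nu>2" if \<mu>: "\<mu> \<in> supp f2" "\<mu> \<noteq> \<nu>2" for \<mu>
      proof -
        have p: "udeg u \<mu> \<le> udeg u \<nu>2" using f2'[OF \<mu>] by auto
        then have "- V * (udeg u \<mu> - udeg u \<nu>2) \<le> v * (udeg u \<mu> - udeg u \<nu>2)"
          using 2 by (intro mult_right_mono_neg) auto
        then show ?thesis using \<delta>(4)[of \<mu>] \<mu> p by (auto simp: m_def)
      qed
      then show ?thesis using 2 V(1) by (intro bexI[of _ "(f2, \<nu>2)"]) (auto simp: T_def m_def)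
    next
      case 3
      then obtain f \<nu> n where Yf: "(f, \<nu>, n) \<in> Y" "v \<in> U (f, \<nu>, n)" using Y(3) by fast
      have "\<delta> \<le> m \<nu> \<mu> v" if \<mu>: "\<mu> \<in> supp f" "\<mu> \<noteq> \<nu>" for \<mu>
      proof -
        have "inverse (real (Suc n)) < m \<nu> \<mu> v" using Yf(2) \<mu> by (auto simp: U_def)
        then show ?thesis using \<delta>(2)[OF Yf(1)] by linarith
      qed
      moreover have "(f, \<nu>) \<in> T" using Yf(1) by (force simp: T_def)
      ultimately show ?thesis using 3 by (intro bexI[of _ "(f, \<nu>)"]) (auto simp: m_def)
    qed
  qed
  then show False using \<omega> by (auto simp: trop_iff)
qed

text \<open>Peels off the vectors from the last to the first; each step moves along one of them, and
  the displacements add up inside the span.\<close>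

lemma trop_core_subset:
  fixes I :: "('n::finite, 'a::field) mpoly set"
  assumes "graded_ideal I" "\<omega> \<in> trop (core u l I)"
  shows "\<exists>v\<in>span ((\<lambda>j. int_vec (u j)) ` {..<l}). \<omega> + v \<in> trop I"
  using assms(2)
proof (induction l arbitrary: \<omega>)
  case 0
  then show ?case by (simp add: core_0)
next
  case (Suc l)
  have "graded_ideal (core u l I)"
    by (induction l) (simp_all add: core_0 core_Suc assms(1) graded_core1)
  then obtain c where "\<omega> + c *\<^sub>R int_vec (u l) \<in> trop (core u l I)"
    using trop_core1_subset Suc.prems by (metis core_Suc)
  then obtain v where v: "v \<in> span ((\<lambda>j. int_vec (u j)) ` {..<l})"
    "\<omega> + c *\<^sub>R int_vec (u l) + v \<in> trop I"
    using Suc.IH by blast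
  have "c *\<^sub>R int_vec (u l) + v \<in> span ((\<lambda>j. int_vec (u j)) ` {..<Suc l})"
    by (intro span_add span_scale span_base subsetD[OF span_mono v(1)]) auto
  with v(2) show ?case by (metis add.assoc)
qed

section \<open>Fibres of the projection\<close>

theorem theorem6p1:
  fixes I :: "('n::finite, 'a::field_char_0) mpoly set"
  assumes alg_closed: "\<forall>p::'a poly. degree p > 0 \<longrightarrow> (\<exists>z. poly p z = 0)"
    and graded: "graded_ideal I"
    and m_lt_n: "CARD('m::finite) \<le> CARD('n)"
  shows "\<exists>D. Pi_open CARD('m) D \<and> Pi_dense CARD('m) D \<and>
    (\<forall>(A::real^'n^'m) (u::nat \<Rightarrow> int^'n).
       rational_matrix A \<and> rank A = CARD('m) \<and> {x. A *v x = 0} \<in> D \<and>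
       inj_on (\<lambda>j. int_vec (u j)) {..<CARD('n) - CARD('m)} \<and>
       independent ((\<lambda>j. int_vec (u j)) ` {..<CARD('n) - CARD('m)}) \<and>
       span ((\<lambda>j. int_vec (u j)) ` {..<CARD('n) - CARD('m)}) = {x. A *v x = 0}
       \<longrightarrow> {\<omega>. \<exists>\<omega>'\<in>trop I. A *v \<omega> = A *v \<omega>'} = trop (J0_tilde I u (CARD('n) - CARD('m))))"
proof (intro exI[of _ "PiSpace CARD('m)"] conjI allI impI)
  show "Pi_open CARD('m) (PiSpace CARD('m) :: (real^'n) set set)"
    unfolding Pi_open_def by (auto intro!: exI[of _ "{}"])
  show "Pi_dense CARD('m) (PiSpace CARD('m) :: (real^'n) set set)"
    unfolding Pi_dense_def Pi_open_def by blast
  fix A :: "real^'n^'m" and u :: "nat \<Rightarrow> int^'n"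
  define l where "l = CARD('n) - CARD('m)"
  assume "rational_matrix A \<and> rank A = CARD('m) \<and> {x. A *v x = 0} \<in> PiSpace CARD('m) \<and>
       inj_on (\<lambda>j. int_vec (u j)) {..<CARD('n) - CARD('m)} \<and>
       independent ((\<lambda>j. int_vec (u j)) ` {..<CARD('n) - CARD('m)}) \<and>
       span ((\<lambda>j. int_vec (u j)) ` {..<CARD('n) - CARD('m)}) = {x. A *v x = 0}"
  \<comment> \<open>The vectors span the kernel, so equal images under \<open>A\<close> mean a
    difference in the span.\<close>
  then have ker: "v \<in> span ((\<lambda>j. int_vec (u j)) ` {..<l}) \<longleftrightarrow> A *v v = 0" for v
    by (auto simp: l_def)
  have I: "is_ideal_set I" using graded by (simp add: graded_ideal_def)
  show "{\<omega>. \<exists>\<omega>'\<in>trop I. A *v \<omega> = A *v \<omega>'} = trop (J0_tilde I u (CARD('n) - CARD('m)))"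
    unfolding J0_tilde_eq_core[OF I] l_def[symmetric]
  proof (intro set_eqI iffI)
    fix \<omega> assume "\<omega> \<in> {\<omega>. \<exists>\<omega>'\<in>trop I. A *v \<omega> = A *v \<omega>'}"
    then obtain \<omega>' where \<omega>': "\<omega>' \<in> trop I" "A *v \<omega> = A *v \<omega>'" by blast
    then have "\<omega> - \<omega>' \<in> span ((\<lambda>j. int_vec (u j)) ` {..<l})"
      by (simp add: ker matrix_vector_mult_diff_distrib)
    from trop_core_superset[OF \<omega>'(1) this] show "\<omega> \<in> trop (core u l I)" by simp
  next
    fix \<omega> assume "\<omega> \<in> trop (core u l I)"
    from trop_core_subset[OF graded this] obtain v where
      "v \<in> span ((\<lambda>j. int_vec (u j)) ` {..<l})" "\<omega> + v \<in> trop I" by blast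
    then show "\<omega> \<in> {\<omega>. \<exists>\<omega>'\<in>trop I. A *v \<omega> = A *v \<omega>'}"
      by (auto simp: ker matrix_vector_right_distrib intro!: bexI[of _ "\<omega> + v"])
  qed
qed

end
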